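(* Let $D\subset\mathbb{R}^2$ be a bounded, simply connected open set with $C^\infty$ boundary $\Gamma=\partial D$ of length $L$, and let $\gamma\in C^\infty([0,L],\mathbb{R}^2)$ be an arc-length parametrization of $\Gamma$. Let $\alpha>0$, $k>0$ and $\lambda$ be constants, and let $u$ be the scattered field of the impenetrable scattering problem described in the context (with sound-soft, sound-hard or impedance boundary condition). Then for every integer $N\ge 0$ the $N$th order normal derivative $\partial_{\mathbf{n}}^N u$ on $\Gamma$ is a linear combination of the functions $\partial_{\boldsymbol{\tau}}^j u$ and $\partial_{\boldsymbol{\tau}}^j\partial_{\mathbf{n}}u$ on $\Gamma$, $0\le j\le N$; that is, there are functions $a^N_j, b^N_j$ on $\Gamma$, not depending on $u$, such that $$\partial_{\mathbf{n}}^N u=\sum_{j=0}^N a^N_j\,\partial_{\boldsymbol{\tau}}^j u+\sum_{j=0}^{N} b^N_j\,\partial_{\boldsymbol{\tau}}^j\partial_{\mathbf{n}}u\quad\text{on }\Gamma.$$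
   Context: Setting: $D_{\rm ex}=\mathbb{R}^2\setminus\overline{D}$. An incident field $\phi$ (a plane wave $e^{ik\mathbf{x}\cdot\mathbf{z}}$ with $|\mathbf{z}|=1$, or a point source $\frac{i}{4}H_0^{(1)}(k|\mathbf{x}-\mathbf{x}_s|)$ with $\mathbf{x}_s$ away from $\Gamma$) illuminates $D$. The total field $u_{\rm tot}=\phi+u$ satisfies $\nabla\cdot\alpha\nabla u_{\rm tot}+k^2u_{\rm tot}=0$ in $D_{\rm ex}$ (away from the source) with one of the boundary conditions $u_{\rm tot}=0$, $\mathbf{n}\cdot\alpha\nabla u_{\rm tot}=0$, or $\mathbf{n}\cdot\alpha\nabla u_{\rm tot}+i\lambda u_{\rm tot}=0$ on $\Gamma$; the scattered field $u$ solves the homogeneous Helmholtz equation $\nabla\cdot\alpha\nabla u+k^2u=0$ in $D_{\rm ex}$, is smooth up to $\Gamma$ from $D_{\rm ex}$, and satisfies the Sommerfeld radiation condition $\lim_{r\to\infty}\sqrt r(\partial_r u-iku)=0$. Here $\mathbf{n}$ is the unit outward normal, $\boldsymbol{\tau}=\dot\gamma$ the unit tangent; $\partial_{\boldsymbol{\tau}}^j$ denotes the $j$th derivative with respect to arc length $s$ along $\Gamma$. Writing points near $\Gamma$ in $D_{\rm ex}$ as $\mathbf{y}=\gamma(s)+\eta\,\mathbf{n}(s)$ with $\eta>0$ small, $\partial_{\mathbf{n}}^N u$ on $\Gamma$ means $\lim_{\eta\to0^+}\partial_\eta^N u$, and $\partial_{\boldsymbol{\tau}}^j\partial_{\mathbf{n}}u$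 means $\lim_{\eta\to 0^+}\partial_s^j\partial_\eta u$. *)

theory Defs
  imports "HOL-Analysis.Analysis"
begin

text \<open>The plane R^2 is modelled by the type complex (x + i y).
  Fields are complex-valued functions on the plane.\<close>

definition bessel_J0 :: "real \<Rightarrow> real" where
  "bessel_J0 x = (\<Sum>m. (-1)^m * (x/2)^(2*m) / (fact m)^2)"

definition bessel_Y0 :: "real \<Rightarrow> real" where
  "bessel_Y0 x = (2/pi) * ((ln (x/2) + euler_mascheroni) * bessel_J0 x
      + (\<Sum>m. (-1)^(m+2) * harm (m+1) * (x/2)^(2*(m+1)) / (fact (m+1))^2))"

definition hankel1_0 :: "real \<Rightarrow> complex" where
  "hankel1_0 x = complex_of_real (bessel_J0 x) + \<i> * complex_of_real (bessel_Y0 x)"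

fun hder :: "nat \<Rightarrow> (real \<Rightarrow> complex) \<Rightarrow> real \<Rightarrow> complex" where
  "hder 0 f = f"
| "hder (Suc n) f = (\<lambda>t. vector_derivative (hder n f) (at t))"

definition smooth_real_fun :: "(real \<Rightarrow> complex) \<Rightarrow> bool" where
  "smooth_real_fun f \<longleftrightarrow> (\<forall>n t. hder n f differentiable (at t))"

definition cdir :: "bool \<Rightarrow> complex" where
  "cdir b = (if b then 1 else \<i>)"

definition partial :: "bool \<Rightarrow> (complex \<Rightarrow> complex) \<Rightarrow> complex \<Rightarrow> complex" where
  "partial b f z = vector_derivative (\<lambda>t. f (z + of_real t * cdir b)) (at 0)"

fun pder :: "bool list \<Rightarrow> (complex \<Rightarrow> complex) \<Rightarrow> complex \<Rightarrow> complex" where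
  "pder [] f = f"
| "pder (b # bs) f = partial b (pder bs f)"

definition smooth_on :: "complex set \<Rightarrow> (complex \<Rightarrow> complex) \<Rightarrow> bool" where
  "smooth_on S f \<longleftrightarrow> (\<forall>ds. continuous_on S (pder ds f) \<and>
      (\<forall>z\<in>S. \<forall>b. (\<lambda>t. pder ds f (z + of_real t * cdir b)) differentiable (at 0)))"

definition smooth_up_to_boundary :: "complex set \<Rightarrow> (complex \<Rightarrow> complex) \<Rightarrow> bool" where
  "smooth_up_to_boundary S f \<longleftrightarrow> smooth_on S f \<and>
      (\<forall>ds. \<exists>g. continuous_on (closure S) g \<and> (\<forall>z\<in>S. g z = pder ds f z))"

definition exterior :: "complex set \<Rightarrow> complex set" where
  "exterior D = - closure D"

definition out_normal :: "complex set \<Rightarrow> (real \<Rightarrow> complex) \<Rightarrow> real \<Rightarrow> complex" where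
  "out_normal D \<gamma> s =
     (let \<tau> = vector_derivative \<gamma> (at s) in
      if eventually (\<lambda>\<eta>. \<gamma> s + of_real \<eta> * (- \<i> * \<tau>) \<in> exterior D) (at_right 0)
      then - \<i> * \<tau> else \<i> * \<tau>)"

definition bcoord :: "complex set \<Rightarrow> (real \<Rightarrow> complex) \<Rightarrow> (complex \<Rightarrow> complex) \<Rightarrow> real \<Rightarrow> real \<Rightarrow> complex" where
  "bcoord D \<gamma> u s \<eta> = u (\<gamma> s + of_real \<eta> * out_normal D \<gamma> s)"

definition dn_bd :: "complex set \<Rightarrow> (real \<Rightarrow> complex) \<Rightarrow> (complex \<Rightarrow> complex) \<Rightarrow> nat \<Rightarrow> real \<Rightarrow> complex" where
  "dn_bd D \<gamma> u N s = Lim (at_right 0) (\<lambda>\<eta>. hder N (bcoord D \<gamma> u s) \<eta>)"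

definition dt_bd :: "complex set \<Rightarrow> (real \<Rightarrow> complex) \<Rightarrow> (complex \<Rightarrow> complex) \<Rightarrow> nat \<Rightarrow> real \<Rightarrow> complex" where
  "dt_bd D \<gamma> u j s = Lim (at_right 0) (\<lambda>\<eta>. hder j (\<lambda>s'. bcoord D \<gamma> u s' \<eta>) s)"

definition dtdn_bd :: "complex set \<Rightarrow> (real \<Rightarrow> complex) \<Rightarrow> (complex \<Rightarrow> complex) \<Rightarrow> nat \<Rightarrow> real \<Rightarrow> complex" where
  "dtdn_bd D \<gamma> u j s =
     Lim (at_right 0) (\<lambda>\<eta>. hder j (\<lambda>s'. hder 1 (bcoord D \<gamma> u s') \<eta>) s)"

definition plane_wave :: "real \<Rightarrow> complex \<Rightarrow> complex \<Rightarrow> complex" where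
  "plane_wave k d = (\<lambda>x. exp (\<i> * of_real k * of_real (x \<bullet> d)))"

definition point_source :: "real \<Rightarrow> complex \<Rightarrow> complex \<Rightarrow> complex" where
  "point_source k xs = (\<lambda>x. \<i> / 4 * hankel1_0 (k * dist x xs))"

definition incident_field :: "complex set \<Rightarrow> real \<Rightarrow> (complex \<Rightarrow> complex) \<Rightarrow> bool" where
  "incident_field D k \<phi> \<longleftrightarrow>
     (\<exists>d. norm d = 1 \<and> \<phi> = plane_wave k d) \<or>
     (\<exists>xs. xs \<notin> frontier D \<and> \<phi> = point_source k xs)"

definition radiating :: "real \<Rightarrow> (complex \<Rightarrow> complex) \<Rightarrow> bool" where
  "radiating k u \<longleftrightarrow> (\<forall>\<epsilon>>0. \<exists>R. \<forall>x. R \<le> norm x \<longrightarrow>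
      sqrt (norm x) * norm (vector_derivative (\<lambda>t. u (x + of_real t * sgn x)) (at 0)
                               - \<i> * of_real k * u x) < \<epsilon>)"

definition helmholtz_on :: "complex set \<Rightarrow> real \<Rightarrow> real \<Rightarrow> (complex \<Rightarrow> complex) \<Rightarrow> bool" where
  "helmholtz_on S \<alpha> k u \<longleftrightarrow> (\<forall>z\<in>S.
      of_real \<alpha> * (pder [True, True] u z + pder [False, False] u z) + of_real (k^2) * u z = 0)"

definition sound_soft :: "complex set \<Rightarrow> (real \<Rightarrow> complex) \<Rightarrow> real \<Rightarrow> (complex \<Rightarrow> complex) \<Rightarrow> bool" where
  "sound_soft D \<gamma> L w \<longleftrightarrow> (\<forall>s\<in>{0..L}. (bcoord D \<gamma> w s \<longlongrightarrow> 0) (at_right 0))"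

definition sound_hard :: "complex set \<Rightarrow> (real \<Rightarrow> complex) \<Rightarrow> real \<Rightarrow> real \<Rightarrow> (complex \<Rightarrow> complex) \<Rightarrow> bool" where
  "sound_hard D \<gamma> L \<alpha> w \<longleftrightarrow> (\<forall>s\<in>{0..L}.
      ((\<lambda>\<eta>. of_real \<alpha> * hder 1 (bcoord D \<gamma> w s) \<eta>) \<longlongrightarrow> 0) (at_right 0))"

definition impedance_bc :: "complex set \<Rightarrow> (real \<Rightarrow> complex) \<Rightarrow> real \<Rightarrow> real \<Rightarrow> real \<Rightarrow> (complex \<Rightarrow> complex) \<Rightarrow> bool" where
  "impedance_bc D \<gamma> L \<alpha> imp w \<longleftrightarrow> (\<forall>s\<in>{0..L}.
      ((\<lambda>\<eta>. of_real \<alpha> * hder 1 (bcoord D \<gamma> w s) \<eta> + \<i> * of_real imp * bcoord D \<gamma> w s \<eta>)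
         \<longlongrightarrow> 0) (at_right 0))"

definition scattered_field ::
  "complex set \<Rightarrow> (real \<Rightarrow> complex) \<Rightarrow> real \<Rightarrow> real \<Rightarrow> real \<Rightarrow> real \<Rightarrow> (complex \<Rightarrow> complex) \<Rightarrow> bool" where
  "scattered_field D \<gamma> L \<alpha> k imp u \<longleftrightarrow>
     (\<exists>\<phi>. incident_field D k \<phi> \<and>
        helmholtz_on (exterior D) \<alpha> k u \<and>
        smooth_up_to_boundary (exterior D) u \<and>
        radiating k u \<and>
        (sound_soft D \<gamma> L (\<lambda>x. \<phi> x + u x) \<or>
         sound_hard D \<gamma> L \<alpha> (\<lambda>x. \<phi> x + u x) \<or>
         impedance_bc D \<gamma> L \<alpha> imp (\<lambda>x. \<phi> x + u x)))"

end

theory Submission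
  imports Defs
begin

text \<open>The coefficients need no regularity in \<open>s\<close>, so fix one boundary point. In complex notation
  the Helmholtz equation reads \<open>\<partial>\<partial>bar u = q u\<close> with a constant \<open>q\<close>, so that all derivatives of \<open>u\<close> of order
  at most \<open>N\<close> are combinations of the pure derivatives \<open>\<partial>\<^sup>i u\<close> and \<open>(\<partial>bar)\<^sup>i u\<close> with \<open>i \<le> N\<close>;
  in particular this holds for the normal derivative of order \<open>N\<close>. Conversely, differentiating
  \<open>u\<close> and its normal derivative along the curve produces, up to pure derivatives of lower order, two linearly
  independent combinations of the two pure derivatives of order \<open>N\<close>. Inverting this triangular
  system expresses the boundary values of all pure derivatives through the tangential
  derivatives of \<open>u\<close> and of its normal derivative. For the limits at the boundary to make sense, the
  prescribed normal must be a fixed rotation of the tangent near the point, with a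
  one-sided strip in the exterior; this follows from the Jordan curve theorem.\<close>

section \<open>Smooth functions on open subsets of the plane\<close>

text \<open>Two definitions shape the work. \<open>smooth_on\<close> speaks of iterated partial
  derivatives only, so total differentiability and the symmetry of mixed partials, on which the
  chain rule and the factorisation of the Laplacian rest, have to be derived. The boundary
  derivatives are given by \<open>Lim\<close>, which has content only where convergence is known;
  each of them is therefore reduced to limits of pure derivatives, which exist because all partials
  extend continuously to the boundary.

  The system is triangular because a use of the Helmholtz equation lowers the total order by two and
  so never disturbs a leading part. It is square because each order N >= 1 has exactly two pure
  derivatives, matched by N tangential derivatives of u and N - 1 of its normal derivative.
  Independence of u comes from building all coefficients from the curve, \<eta> and q alone.

  The Jordan curve theorem enters because a frontier that is a smooth curve does not by itself rule
  out that D lies on both sides of an arc.\<close>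

lemma second_difference_mean_value:
  fixes g gx gxy :: "real \<Rightarrow> real \<Rightarrow> real"
  assumes "0 < h" "h < r"
    and gx: "\<And>s t. \<bar>s\<bar> < r \<Longrightarrow> \<bar>t\<bar> < r \<Longrightarrow> ((\<lambda>s. g s t) has_real_derivative gx s t) (at s)"
    and gxy: "\<And>s t. \<bar>s\<bar> < r \<Longrightarrow> \<bar>t\<bar> < r \<Longrightarrow> ((\<lambda>t. gx s t) has_real_derivative gxy s t) (at t)"
  obtains s t where "0 < s" "s < h" "0 < t" "t < h"
    "g h h - g h 0 - g 0 h + g 0 0 = h * h * gxy s t"
proof -
  have "\<exists>s>0. s < h \<and> (g h h - g h 0) - (g 0 h - g 0 0) = (h - 0) * (gx s h - gx s 0)"
    by (rule MVT2) (use assms in \<open>auto intro!: DERIV_diff gx\<close>)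
  then obtain s where s: "0 < s" "s < h"
    "(g h h - g h 0) - (g 0 h - g 0 0) = h * (gx s h - gx s 0)" by auto
  have "\<exists>t>0. t < h \<and> gx s h - gx s 0 = (h - 0) * gxy s t"
    by (rule MVT2) (use assms s in \<open>auto intro!: gxy\<close>)
  then obtain t where "0 < t" "t < h" "gx s h - gx s 0 = h * gxy s t" by auto
  with s show thesis by (intro that[of s t]) (auto simp: algebra_simps)
qed

text \<open>The same second difference over a square of side h equals h^2 times a value of either
  mixed partial in that square, so continuity at the origin forces the two to agree there.\<close>

lemma real_mixed_partials_eq:
  fixes g gx gy gxy gyx :: "real \<Rightarrow> real \<Rightarrow> real"
  assumes "0 < r"
    and gx: "\<And>s t. \<bar>s\<bar> < r \<Longrightarrow> \<bar>t\<bar> < r \<Longrightarrow> ((\<lambda>s. g s t) has_real_derivative gx s t) (at s)"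
    and gy: "\<And>s t. \<bar>s\<bar> < r \<Longrightarrow> \<bar>t\<bar> < r \<Longrightarrow> ((\<lambda>t. g s t) has_real_derivative gy s t) (at t)"
    and gxy: "\<And>s t. \<bar>s\<bar> < r \<Longrightarrow> \<bar>t\<bar> < r \<Longrightarrow> ((\<lambda>t. gx s t) has_real_derivative gxy s t) (at t)"
    and gyx: "\<And>s t. \<bar>s\<bar> < r \<Longrightarrow> \<bar>t\<bar> < r \<Longrightarrow> ((\<lambda>s. gy s t) has_real_derivative gyx s t) (at s)"
    and cxy: "((\<lambda>(s, t). gxy s t) \<longlongrightarrow> gxy 0 0) (nhds (0, 0))"
    and cyx: "((\<lambda>(s, t). gyx s t) \<longlongrightarrow> gyx 0 0) (nhds (0, 0))"
  shows "gxy 0 0 = gyx 0 0"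
proof (rule ccontr)
  assume ne: "gxy 0 0 \<noteq> gyx 0 0"
  \<comment> \<open>Half the gap, so that numbers within \<open>e\<close> of \<open>gxy 0 0\<close>
    and of \<open>gyx 0 0\<close> cannot coincide.\<close>
  define e where "e = \<bar>gxy 0 0 - gyx 0 0\<bar> / 2"
  have e: "e > 0" using ne by (simp add: e_def)
  have near: "\<exists>d>0. \<forall>s t. \<bar>s\<bar> < d \<longrightarrow> \<bar>t\<bar> < d \<longrightarrow> \<bar>G s t - G 0 0\<bar> < e"
    if "((\<lambda>(s, t). G s t) \<longlongrightarrow> G 0 0) (nhds (0, 0))" for G :: "real \<Rightarrow> real \<Rightarrow> real"
  proof -
    from tendstoD[OF that e] obtain d where d: "d > 0"
      "\<And>p. dist p (0, 0) < d \<Longrightarrow> dist (case p of (s, t) \<Rightarrow> G s t) (G 0 0) < e"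
      by (auto simp: eventually_nhds_metric)
    have "\<bar>G s t - G 0 0\<bar> < e" if "\<bar>s\<bar> < d / 2" "\<bar>t\<bar> < d / 2" for s t
    proof -
      have "dist (s, t) (0, 0) \<le> \<bar>s\<bar> + \<bar>t\<bar>"
        by (simp add: dist_Pair_Pair sqrt_sum_squares_le_sum_abs)
      also have "\<dots> < d" using that by simp
      finally show ?thesis using d(2)[of "(s, t)"] by (simp add: dist_real_def)
    qed
    with d(1) show ?thesis by (intro exI[of _ "d / 2"]) auto
  qed
  obtain d1 where d1: "d1 > 0" "\<And>s t. \<bar>s\<bar> < d1 \<Longrightarrow> \<bar>t\<bar> < d1 \<Longrightarrow> \<bar>gxy s t - gxy 0 0\<bar> < e"
    using near[OF cxy] by auto
  obtain d2 where d2: "d2 > 0" "\<And>s t. \<bar>s\<bar> < d2 \<Longrightarrow> \<bar>t\<bar> < d2 \<Longrightarrow> \<bar>gyx s t - gyx 0 0\<bar> < e"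
    using near[OF cyx] by auto
  define h where "h = min r (min d1 d2) / 2"
  have h: "0 < h" "h < r" "h < d1" "h < d2" using d1(1) d2(1) \<open>0 < r\<close> by (auto simp: h_def min_def)
  obtain s t where st: "0 < s" "s < h" "0 < t" "t < h"
    "g h h - g h 0 - g 0 h + g 0 0 = h * h * gxy s t"
    using second_difference_mean_value[where g = g and gx = gx and gxy = gxy, OF h(1,2) gx gxy] .
  \<comment> \<open>With the variables exchanged the same lemma yields the other mixed partial; the
    two middle terms of the difference merely swap.\<close>
  obtain t' s' where st': "0 < t'" "t' < h" "0 < s'" "s' < h"
    "g h h - g 0 h - g h 0 + g 0 0 = h * h * gyx s' t'"
    using second_difference_mean_value[where g = "\<lambda>t s. g s t" and gx = "\<lambda>t s. gy s t" and
        gxy = "\<lambda>t s. gyx s t", OF h(1,2) gy gyx] .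
  have "h * h * gxy s t = h * h * gyx s' t'" using st(5) st'(5) by linarith
  then have "gxy s t = gyx s' t'" using h(1) by simp
  moreover have "\<bar>gxy s t - gxy 0 0\<bar> < e" using st h by (intro d1) auto
  moreover have "\<bar>gyx s' t' - gyx 0 0\<bar> < e" using st' h by (intro d2) auto
  ultimately show False unfolding e_def by (simp add: abs_if split: if_splits)
qed

section \<open>Closure of the smoothness classes under partial derivatives and linear
  combinations\<close>

lemma smooth_on_if_smooth_up_to_boundary: "smooth_up_to_boundary S f \<Longrightarrow> smooth_on S f"
  by (simp add: smooth_up_to_boundary_def)

lemma pder_append: "pder (ds @ es) f = pder ds (pder es f)"
  by (induction ds) auto

lemma smooth_on_partial:
  assumes "smooth_on S f" shows "smooth_on S (partial b f)"
proof -
  have "pder ds (partial b f) = pder (ds @ [b]) f" for ds by (simp add: pder_append)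
  then show ?thesis using assms unfolding smooth_on_def by metis
qed

lemma smooth_up_to_boundary_partial:
  assumes "smooth_up_to_boundary S f" shows "smooth_up_to_boundary S (partial b f)"
proof -
  have "pder ds (partial b f) = pder (ds @ [b]) f" for ds by (simp add: pder_append)
  then show ?thesis using assms smooth_on_partial unfolding smooth_up_to_boundary_def by metis
qed

lemma smooth_on_has_partial:
  assumes "smooth_on S f" "z \<in> S"
  shows "((\<lambda>t. f (z + of_real t * cdir b)) has_vector_derivative partial b f z) (at 0)"
proof -
  have "(\<lambda>t. pder [] f (z + of_real t * cdir b)) differentiable (at 0)"
    using assms unfolding smooth_on_def by blast
  then show ?thesis by (simp add: partial_def vector_derivative_works)
qed

text \<open>The definition supplies derivatives at parameter 0 only; translating the base point
  along the line gives them at every parameter, as theorems about functions of one variable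
  require.\<close>

lemma smooth_on_has_partial_along:
  assumes "smooth_on S f" "z + of_real s * cdir b \<in> S"
  shows "((\<lambda>t. f (z + of_real t * cdir b)) has_vector_derivative partial b f (z + of_real s * cdir b)) (at s)"
proof -
  have "((\<lambda>t. f (z + of_real s * cdir b + of_real t * cdir b)) has_vector_derivative
      partial b f (z + of_real s * cdir b)) (at (s - s))"
    using smooth_on_has_partial[OF assms] by simp
  moreover have "((\<lambda>t. t - s) has_vector_derivative 1) (at s)"
    by (auto intro!: derivative_eq_intros)
  ultimately have "((\<lambda>t. f (z + of_real s * cdir b + of_real t * cdir b)) \<circ> (\<lambda>t. t - s) has_vector_derivative
      1 *\<^sub>R partial b f (z + of_real s * cdir b)) (at s)"
    by (intro vector_diff_chain_at) auto
  then show ?thesis by (simp add: o_def algebra_simps)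
qed

lemma smooth_on_continuous:
  assumes "smooth_on S f" shows "continuous_on S f"
proof -
  have "continuous_on S (pder [] f)" using assms unfolding smooth_on_def by blast
  then show ?thesis by simp
qed

lemma partial_cong:
  assumes "open S" "z \<in> S" "\<And>w. w \<in> S \<Longrightarrow> f w = g w"
  shows "partial b f z = partial b g z"
  unfolding partial_def
proof (rule vector_derivative_cong_eq)
  have "((\<lambda>t::real. z + of_real t * cdir b) \<longlongrightarrow> z + of_real 0 * cdir b) (nhds 0)"
    by (intro tendsto_intros filterlim_ident)
  then have "\<forall>\<^sub>F t in nhds (0::real). z + of_real t * cdir b \<in> S"
    using assms by (intro topological_tendstoD) auto
  then show "\<forall>\<^sub>F t in nhds 0. t \<in> UNIV \<longrightarrow> f (z + of_real t * cdir b) = g (z + of_real t * cdir b)"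
    by eventually_elim (use assms in auto)
qed auto

lemma partial_linear:
  assumes "smooth_on S f" "smooth_on S g" "z \<in> S"
  shows "((\<lambda>t. a * f (z + of_real t * cdir c) + b * g (z + of_real t * cdir c)) has_vector_derivative
      a * partial c f z + b * partial c g z) (at 0)"
  using smooth_on_has_partial[OF assms(1,3), of c] smooth_on_has_partial[OF assms(2,3), of c]
  by (auto intro!: derivative_eq_intros)

lemma smooth_on_pder: "smooth_on S f \<Longrightarrow> smooth_on S (pder ds f)"
  by (induction ds) (auto intro: smooth_on_partial)

lemma pder_linear:
  assumes "open S" "smooth_on S f" "smooth_on S g" "z \<in> S"
  shows "pder ds (\<lambda>z. a * f z + b * g z) z = a * pder ds f z + b * pder ds g z"
  using assms(4)
proof (induction ds arbitrary: z)
  case (Cons c ds)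
  have "partial c (pder ds (\<lambda>z. a * f z + b * g z)) z =
      partial c (\<lambda>z. a * pder ds f z + b * pder ds g z) z"
    using assms(1) Cons by (intro partial_cong) auto
  also have "\<dots> = a * partial c (pder ds f) z + b * partial c (pder ds g) z"
    unfolding partial_def[of c "\<lambda>z. a * pder ds f z + b * pder ds g z"]
    using assms Cons by (intro vector_derivative_at partial_linear smooth_on_pder) auto
  finally show ?case by simp
qed simp

lemma smooth_on_linear:
  assumes "open S" "smooth_on S f" "smooth_on S g"
  shows "smooth_on S (\<lambda>z. a * f z + b * g z)" (is "smooth_on S ?h")
  unfolding smooth_on_def
proof (intro allI conjI ballI)
  note eq = pder_linear[OF assms, of _ _ a b]
  show "continuous_on S (pder ds ?h)" for ds
  proof -
    have "continuous_on S (\<lambda>z. a * pder ds f z + b * pder ds g z)"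
      by (intro continuous_intros smooth_on_continuous smooth_on_pder assms)
    then show ?thesis by (subst continuous_on_cong[OF refl eq]) auto
  qed
  fix ds z c assume z: "z \<in> S"
  have "((\<lambda>t::real. z + of_real t * cdir c) \<longlongrightarrow> z + of_real 0 * cdir c) (nhds 0)"
    by (intro tendsto_intros filterlim_ident)
  then have "\<forall>\<^sub>F t in nhds (0::real). z + of_real t * cdir c \<in> S"
    using assms z by (intro topological_tendstoD) auto
  \<comment> \<open>The linear formula for \<open>pder ds\<close> holds on S only, so
    differentiability is transferred through agreement near the point.\<close>
  then have ev: "\<forall>\<^sub>F t in nhds (0::real). t \<in> UNIV \<longrightarrow>
      a * pder ds f (z + of_real t * cdir c) + b * pder ds g (z + of_real t * cdir c) = pder ds ?h (z + of_real t * cdir c)"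
    by eventually_elim (simp add: eq)
  have at0: "a * pder ds f (z + of_real 0 * cdir c) + b * pder ds g (z + of_real 0 * cdir c) = pder ds ?h (z + of_real 0 * cdir c)"
    using z by (simp add: eq)
  have "((\<lambda>t. a * pder ds f (z + of_real t * cdir c) + b * pder ds g (z + of_real t * cdir c)) has_vector_derivative
      a * partial c (pder ds f) z + b * partial c (pder ds g) z) (at 0)"
    using assms z by (intro partial_linear smooth_on_pder) auto
  then have "((\<lambda>t. pder ds ?h (z + of_real t * cdir c)) has_vector_derivative
      a * partial c (pder ds f) z + b * partial c (pder ds g) z) (at 0)"
    using has_vector_derivative_cong_ev[OF ev at0] by simp
  then show "(\<lambda>t. pder ds ?h (z + of_real t * cdir c)) differentiable (at 0)"
    by (auto simp: has_vector_derivative_def differentiable_def)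
qed

lemma smooth_up_to_boundary_linear:
  assumes "open S" "smooth_up_to_boundary S f" "smooth_up_to_boundary S g"
  shows "smooth_up_to_boundary S (\<lambda>z. a * f z + b * g z)" (is "smooth_up_to_boundary S ?h")
  unfolding smooth_up_to_boundary_def
proof (intro conjI allI)
  note sm = assms(2,3)[THEN smooth_on_if_smooth_up_to_boundary]
  show "smooth_on S ?h" using assms(1) sm by (rule smooth_on_linear)
  fix ds
  obtain F where F: "continuous_on (closure S) F" "\<And>z. z \<in> S \<Longrightarrow> F z = pder ds f z"
    using assms(2) unfolding smooth_up_to_boundary_def by metis
  obtain G where G: "continuous_on (closure S) G" "\<And>z. z \<in> S \<Longrightarrow> G z = pder ds g z"
    using assms(3) unfolding smooth_up_to_boundary_def by metis
  show "\<exists>H. continuous_on (closure S) H \<and> (\<forall>z\<in>S. H z = pder ds ?h z)"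
    using F G pder_linear[OF assms(1) sm]
    by (intro exI[of _ "\<lambda>z. a * F z + b * G z"]) (auto intro!: continuous_intros)
qed

text \<open>One partial derivative at the point together with joint continuity of the other on a box
  suffices; the box is carried between pairs of reals and the plane by
  \<open>Complex\<close>.\<close>

lemma smooth_on_has_derivative:
  assumes "open S" "smooth_on S f" "z \<in> S"
  shows "(f has_derivative (\<lambda>h. of_real (Re h) * partial True f z + of_real (Im h) * partial False f z)) (at z)"
proof -
  obtain e where e: "e > 0" "ball z e \<subseteq> S" using assms by (meson openE)
  define X where "X = ball (Re z) (e / 2)"
  define Y where "Y = ball (Im z) (e / 2)"
  have XY: "Complex x y \<in> S" if "x \<in> X" "y \<in> Y" for x y
  proof -
    have "dist z (Complex x y) \<le> \<bar>Re z - x\<bar> + \<bar>Im z - y\<bar>"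
      using cmod_le[of "z - Complex x y"] by (simp add: dist_norm)
    also have "\<dots> < e" using that by (simp add: X_def Y_def dist_real_def)
    finally show ?thesis using e by auto
  qed
  have zXY: "Re z \<in> X" "Im z \<in> Y" using e by (auto simp: X_def Y_def)
  have split: "Complex x y = Complex 0 y + of_real x * cdir True"
    "Complex x y = Complex x 0 + of_real y * cdir False" for x y
    by (auto simp: complex_eq_iff cdir_def)
  have fx: "((\<lambda>x. f (Complex x y)) has_vector_derivative partial True f (Complex x y)) (at x)"
    if "x \<in> X" "y \<in> Y" for x y
    using smooth_on_has_partial_along[of S f "Complex 0 y" x True, folded split(1)] assms(2) XY[OF that] by simp
  have fy: "((\<lambda>y. f (Complex x y)) has_vector_derivative partial False f (Complex x y)) (at y)"
    if "x \<in> X" "y \<in> Y" for x y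
    using smooth_on_has_partial_along[of S f "Complex x 0" y False, folded split(2)] assms(2) XY[OF that] by simp
  define F where "F = (\<lambda>x y. blinfun_scaleR_left (partial False f (Complex x y)))"
  have cont: "continuous_on (X \<times> Y) (\<lambda>p. partial False f (Complex (fst p) (snd p)))"
    using XY
    by (intro continuous_on_compose2[OF smooth_on_continuous[OF smooth_on_partial[OF assms(2)]]]
        continuous_intros continuous_on_Complex) auto
  have "((\<lambda>(x, y). f (Complex x y)) has_derivative
      (\<lambda>(tx, ty). tx *\<^sub>R partial True f z + F (Re z) (Im z) ty)) (at (Re z, Im z) within X \<times> Y)"
  proof (rule has_derivative_partialsI)
    show "((\<lambda>x. f (Complex x (Im z))) has_derivative (\<lambda>tx. tx *\<^sub>R partial True f z)) (at (Re z) within X)"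
      using fx[OF zXY] by (auto simp: has_vector_derivative_def intro: has_derivative_at_withinI)
    show "((\<lambda>y. f (Complex x y)) has_derivative blinfun_apply (F x y)) (at y within Y)"
      if "x \<in> X" "y \<in> Y" for x y
      using fy[OF that] by (auto simp: has_vector_derivative_def F_def intro: has_derivative_at_withinI)
    have "continuous_on (X \<times> Y) (\<lambda>(x, y). F x y)"
      using cont unfolding F_def case_prod_unfold by (intro bounded_linear.continuous_on[OF bounded_linear_blinfun_scaleR_left])
    then show "continuous (at (Re z, Im z) within X \<times> Y) (\<lambda>(x, y). F x y)"
      using zXY by (simp add: continuous_on_eq_continuous_within)
    show "Im z \<in> Y" by (rule zXY)
    show "convex Y" by (simp add: Y_def)
  qed
  moreover have "at (Re z, Im z) within X \<times> Y = at (Re z, Im z)"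
    using zXY by (intro at_within_open) (auto simp: X_def Y_def open_Times)
  ultimately have "((\<lambda>(x, y). f (Complex x y)) has_derivative
      (\<lambda>(tx, ty). tx *\<^sub>R partial True f z + ty *\<^sub>R partial False f z)) (at (Re z, Im z))"
    by (simp add: F_def)
  moreover have "((\<lambda>w. (Re w, Im w)) has_derivative (\<lambda>h. (Re h, Im h))) (at z)"
    by (intro has_derivative_Pair bounded_linear_imp_has_derivative bounded_linear_Re bounded_linear_Im)
  ultimately have "((\<lambda>(x, y). f (Complex x y)) \<circ> (\<lambda>w. (Re w, Im w)) has_derivative
      (\<lambda>(tx, ty). tx *\<^sub>R partial True f z + ty *\<^sub>R partial False f z) \<circ> (\<lambda>h. (Re h, Im h))) (at z)"
    by (intro diff_chain_at)
  then have "(f has_derivative (\<lambda>h. Re h *\<^sub>R partial True f z + Im h *\<^sub>R partial False f z)) (at z)"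
    by (simp add: o_def)
  then show ?thesis by (simp add: scaleR_conv_of_real)
qed

text \<open>The mean value theorem fails for complex values, so the real version is applied to the
  real and imaginary parts, both covered by an arbitrary bounded real-linear functional
  \<open>T\<close>.\<close>

lemma smooth_on_mixed_partials:
  assumes "open S" "smooth_on S f" "z \<in> S"
  shows "partial True (partial False f) z = partial False (partial True f) z"
proof -
  obtain e where e: "e > 0" "ball z e \<subseteq> S" using assms by (meson openE)
  define r where "r = e / 2"
  define p where "p = (\<lambda>s t. z + Complex s t)"
  have r: "r > 0" using e by (simp add: r_def)
  have inS: "p s t \<in> S" if "\<bar>s\<bar> < r" "\<bar>t\<bar> < r" for s t
  proof -
    have "dist z (p s t) \<le> \<bar>s\<bar> + \<bar>t\<bar>"
      using cmod_le[of "Complex s t"] by (simp add: dist_norm p_def)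
    also have "\<dots> < e" using that by (simp add: r_def)
    finally show ?thesis using e by auto
  qed
  have split: "p s t = (z + Complex 0 t) + of_real s * cdir True"
    "p s t = (z + Complex s 0) + of_real t * cdir False" for s t
    by (auto simp: complex_eq_iff cdir_def p_def)
  have dx: "((\<lambda>s. g (p s t)) has_vector_derivative partial True g (p s t)) (at s)"
    if "smooth_on S g" "\<bar>s\<bar> < r" "\<bar>t\<bar> < r" for s t g
    using smooth_on_has_partial_along[of S g "z + Complex 0 t" s True, folded split(1)] that(1) inS[OF that(2,3)] by simp
  have dy: "((\<lambda>t. g (p s t)) has_vector_derivative partial False g (p s t)) (at t)"
    if "smooth_on S g" "\<bar>s\<bar> < r" "\<bar>t\<bar> < r" for s t g
    using smooth_on_has_partial_along[of S g "z + Complex s 0" t False, folded split(2)] that(1) inS[OF that(2,3)] by simp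
  have cont: "((\<lambda>(s, t). g (p s t)) \<longlongrightarrow> g (p 0 0)) (nhds (0, 0))" if "smooth_on S g" for g
  proof -
    have "isCont g z" using smooth_on_continuous[OF that] assms
      by (simp add: continuous_on_eq_continuous_at)
    then have "(g \<longlongrightarrow> g z) (nhds z)" by (simp add: continuous_at tendsto_at_iff_tendsto_nhds)
    moreover have "((\<lambda>(s, t). p s t) \<longlongrightarrow> z) (nhds (0, 0))"
    proof -
      define P where "P = (\<lambda>q. z + Complex (fst q) (snd q))"
      have "continuous_on UNIV P"
        unfolding P_def by (intro continuous_intros continuous_on_Complex)
      then have "(P \<longlongrightarrow> P (0, 0)) (at (0, 0))"
        by (simp add: continuous_on_eq_continuous_at continuous_at)
      then have "(P \<longlongrightarrow> P (0, 0)) (nhds (0, 0))" by (simp only: tendsto_at_iff_tendsto_nhds)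
      moreover have "P (0, 0) = z" by (simp add: P_def complex_eq_iff)
      moreover have "P = (\<lambda>(s, t). p s t)" by (auto simp: P_def p_def)
      ultimately show ?thesis by simp
    qed
    ultimately have "((\<lambda>q. g ((\<lambda>(s, t). p s t) q)) \<longlongrightarrow> g z) (nhds (0, 0))"
      by (rule filterlim_compose)
    moreover have "p 0 0 = z" by (simp add: p_def complex_eq_iff)
    ultimately show ?thesis by (simp add: case_prod_unfold)
  qed
  have z: "p 0 0 = z" by (simp add: p_def complex_eq_iff)
  note sx = smooth_on_partial[OF assms(2), of True] and sy = smooth_on_partial[OF assms(2), of False]
  note sxy = smooth_on_partial[OF sx, of False] and syx = smooth_on_partial[OF sy, of True]
  have *: "T (partial False (partial True f) z) = T (partial True (partial False f) z)"
    if T: "bounded_linear T" for T :: "complex \<Rightarrow> real"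
  proof -
    note D = bounded_linear.has_vector_derivative[OF T, folded has_real_derivative_iff_has_vector_derivative]
    have "T (partial False (partial True f) (p 0 0)) = T (partial True (partial False f) (p 0 0))"
    proof (rule real_mixed_partials_eq[where g = "\<lambda>s t. T (f (p s t))" and
          gx = "\<lambda>s t. T (partial True f (p s t))" and gy = "\<lambda>s t. T (partial False f (p s t))" and
          gxy = "\<lambda>s t. T (partial False (partial True f) (p s t))" and
          gyx = "\<lambda>s t. T (partial True (partial False f) (p s t))", OF r])
      show "((\<lambda>(s, t). T (partial False (partial True f) (p s t))) \<longlongrightarrow>
          T (partial False (partial True f) (p 0 0))) (nhds (0, 0))"
        using bounded_linear.tendsto[OF T cont[OF sxy]] by (simp add: case_prod_unfold)
      show "((\<lambda>(s, t). T (partial True (partial False f) (p s t))) \<longlongrightarrow>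
          T (partial True (partial False f) (p 0 0))) (nhds (0, 0))"
        using bounded_linear.tendsto[OF T cont[OF syx]] by (simp add: case_prod_unfold)
    qed (auto intro!: D dx dy assms sx sy)
    then show ?thesis by (simp add: z)
  qed
  show ?thesis using *[OF bounded_linear_Re] *[OF bounded_linear_Im] by (simp add: complex_eq_iff)
qed

section \<open>Wirtinger derivatives and the Helmholtz equation\<close>

text \<open>Written literally in the form a * f + b * g, so that the linearity lemmas apply without
  rearrangement.\<close>

definition dz :: "(complex \<Rightarrow> complex) \<Rightarrow> complex \<Rightarrow> complex" where
  "dz f = (\<lambda>z. (1 / 2) * partial True f z + (- \<i> / 2) * partial False f z)"

definition dzbar :: "(complex \<Rightarrow> complex) \<Rightarrow> complex \<Rightarrow> complex" where
  "dzbar f = (\<lambda>z. (1 / 2) * partial True f z + (\<i> / 2) * partial False f z)"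

lemma smooth_up_to_boundary_dz:
  "open S \<Longrightarrow> smooth_up_to_boundary S f \<Longrightarrow> smooth_up_to_boundary S (dz f)"
  unfolding dz_def by (intro smooth_up_to_boundary_linear smooth_up_to_boundary_partial)

lemma smooth_up_to_boundary_dzbar:
  "open S \<Longrightarrow> smooth_up_to_boundary S f \<Longrightarrow> smooth_up_to_boundary S (dzbar f)"
  unfolding dzbar_def by (intro smooth_up_to_boundary_linear smooth_up_to_boundary_partial)

lemma dz_cong:
  assumes "open S" "z \<in> S" "\<And>w. w \<in> S \<Longrightarrow> f w = g w"
  shows "dz f z = dz g z"
proof -
  have "partial b f z = partial b g z" for b using assms by (rule partial_cong)
  then show ?thesis by (simp add: dz_def)
qed

lemma dzbar_cong:
  assumes "open S" "z \<in> S" "\<And>w. w \<in> S \<Longrightarrow> f w = g w"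
  shows "dzbar f z = dzbar g z"
proof -
  have "partial b f z = partial b g z" for b using assms by (rule partial_cong)
  then show ?thesis by (simp add: dzbar_def)
qed

lemma partial_linear_eq:
  assumes "smooth_on S f" "smooth_on S g" "z \<in> S"
  shows "partial c (\<lambda>z. a * f z + b * g z) z = a * partial c f z + b * partial c g z"
  using partial_linear[OF assms] unfolding partial_def[of c "\<lambda>z. a * f z + b * g z"]
  by (rule vector_derivative_at)

lemma dz_scale:
  assumes "smooth_on S f" "z \<in> S"
  shows "dz (\<lambda>z. a * f z) z = a * dz f z"
  using partial_linear_eq[OF assms(1,1,2), of _ a 0] by (simp add: dz_def algebra_simps)

lemma dzbar_scale:
  assumes "smooth_on S f" "z \<in> S"
  shows "dzbar (\<lambda>z. a * f z) z = a * dzbar f z"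
  using partial_linear_eq[OF assms(1,1,2), of _ a 0] by (simp add: dzbar_def algebra_simps)

text \<open>The cross terms carry opposite signs and cancel by the symmetry of the mixed
  partials.\<close>

lemma laplacian_factorisation:
  assumes "open S" "smooth_on S f" "z \<in> S"
  shows "dz (dzbar f) z = (partial True (partial True f) z + partial False (partial False f) z) / 4"
    and "dzbar (dz f) z = (partial True (partial True f) z + partial False (partial False f) z) / 4"
proof -
  have lin: "partial c (\<lambda>z. a * partial True f z + b * partial False f z) z =
      a * partial c (partial True f) z + b * partial c (partial False f) z" for c a b
    using assms by (intro partial_linear_eq[where S = S] smooth_on_partial) auto
  have P: "partial c (dzbar f) z = (1 / 2) * partial c (partial True f) z + (\<i> / 2) * partial c (partial False f) z"
    "partial c (dz f) z = (1 / 2) * partial c (partial True f) z + (- \<i> / 2) * partial c (partial False f) z" for c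
    unfolding dz_def dzbar_def by (rule lin)+
  note mixed = smooth_on_mixed_partials[OF assms]
  show "dz (dzbar f) z = (partial True (partial True f) z + partial False (partial False f) z) / 4"
    unfolding dz_def[of "dzbar f"] P mixed by (simp add: complex_eq_iff field_simps)
  show "dzbar (dz f) z = (partial True (partial True f) z + partial False (partial False f) z) / 4"
    unfolding dzbar_def[of "dz f"] P mixed by (simp add: complex_eq_iff field_simps)
qed

lemma dzbar_dz_commute:
  assumes "open S" "smooth_on S f" "z \<in> S"
  shows "dzbar (dz f) z = dz (dzbar f) z"
  unfolding laplacian_factorisation[OF assms] by (rule refl)

text \<open>The differential of f is the real-linear map sending h to h * \<open>dz f\<close> + cnj
  h * \<open>dzbar f\<close>. In this form differentiation along a curve shifts the index of a pure
  derivative up or down.\<close>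

lemma smooth_on_has_vector_derivative_compose:
  assumes "open S" "smooth_on S f" "g t \<in> S" "(g has_vector_derivative g') (at t)"
  shows "((\<lambda>t. f (g t)) has_vector_derivative g' * dz f (g t) + cnj g' * dzbar f (g t)) (at t)"
proof -
  let ?D = "\<lambda>h. of_real (Re h) * partial True f (g t) + of_real (Im h) * partial False f (g t)"
  have "(f \<circ> g has_derivative ?D \<circ> (\<lambda>h. h *\<^sub>R g')) (at t)"
    using assms(4) smooth_on_has_derivative[OF assms(1,2,3)]
    unfolding has_vector_derivative_def by (rule diff_chain_at)
  moreover have "?D \<circ> (\<lambda>h. h *\<^sub>R g') = (\<lambda>h. h *\<^sub>R (g' * dz f (g t) + cnj g' * dzbar f (g t)))"
  proof
    fix h
    have "g' * dz f (g t) + cnj g' * dzbar f (g t) = ?D g'"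
      by (simp add: dz_def dzbar_def complex_eq_iff field_simps)
    then show "(?D \<circ> (\<lambda>h. h *\<^sub>R g')) h = h *\<^sub>R (g' * dz f (g t) + cnj g' * dzbar f (g t))"
      by (simp add: scaleR_conv_of_real algebra_simps)
  qed
  ultimately show ?thesis by (simp add: has_vector_derivative_def o_def)
qed

text \<open>Modulo the Helmholtz equation the jets of \<open>u\<close> are spanned by the pure derivatives
  \<open>\<partial>\<^sup>i u\<close> and \<open>(\<partial>bar)\<^sup>i u\<close>, which are indexed by \<open>i\<close> and \<open>- i\<close>.\<close>

definition pure_deriv :: "int \<Rightarrow> (complex \<Rightarrow> complex) \<Rightarrow> complex \<Rightarrow> complex" where
  "pure_deriv i u = (if 0 \<le> i then (dz ^^ nat i) u else (dzbar ^^ nat (- i)) u)"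

lemma pure_deriv_0 [simp]: "pure_deriv 0 u = u"
  by (simp add: pure_deriv_def)

lemma dz_pure_deriv: "0 \<le> i \<Longrightarrow> dz (pure_deriv i u) = pure_deriv (i + 1) u"
  by (simp add: pure_deriv_def nat_add_distrib)

lemma dzbar_pure_deriv: "i \<le> 0 \<Longrightarrow> dzbar (pure_deriv i u) = pure_deriv (i - 1) u"
proof -
  assume "i \<le> 0"
  then have "nat (1 - i) = Suc (nat (- i))" by simp
  with \<open>i \<le> 0\<close> show ?thesis by (cases "i = 0") (auto simp: pure_deriv_def)
qed

lemma smooth_up_to_boundary_pure_deriv:
  assumes "open S" "smooth_up_to_boundary S u"
  shows "smooth_up_to_boundary S (pure_deriv i u)"
proof -
  have "smooth_up_to_boundary S ((dz ^^ n) u)" "smooth_up_to_boundary S ((dzbar ^^ n) u)" for n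
    using assms by (induction n) (auto intro: smooth_up_to_boundary_dz smooth_up_to_boundary_dzbar)
  then show ?thesis by (simp add: pure_deriv_def)
qed

text \<open>The coefficients are chosen uniformly over this class, which contains every scattered
  field.\<close>

definition helmholtz_solution :: "complex set \<Rightarrow> real \<Rightarrow> real \<Rightarrow> (complex \<Rightarrow> complex) \<Rightarrow> bool" where
  "helmholtz_solution S \<alpha> k u \<longleftrightarrow> smooth_up_to_boundary S u \<and> helmholtz_on S \<alpha> k u"

text \<open>The constant q that results when the Laplacian in the equation is replaced by 4 times
  \<open>dz\<close> after \<open>dzbar\<close> and the equation is solved for that product.\<close>

definition helmholtz_const :: "real \<Rightarrow> real \<Rightarrow> complex" where
  "helmholtz_const \<alpha> k = - of_real (k\<^sup>2 / (4 * \<alpha>))"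

lemma helmholtz_solution_smooth:
  assumes "open S" "helmholtz_solution S \<alpha> k u"
  shows "smooth_on S (pure_deriv i u)"
  using assms unfolding helmholtz_solution_def
  by (intro smooth_on_if_smooth_up_to_boundary smooth_up_to_boundary_pure_deriv) auto

lemma helmholtz_dz_dzbar:
  assumes "open S" "helmholtz_solution S \<alpha> k u" "\<alpha> > 0" "z \<in> S"
  shows "dz (dzbar u) z = helmholtz_const \<alpha> k * u z" "dzbar (dz u) z = helmholtz_const \<alpha> k * u z"
proof -
  have "complex_of_real \<alpha> * (partial True (partial True u) z + partial False (partial False u) z) + of_real (k\<^sup>2) * u z = 0"
    using assms unfolding helmholtz_solution_def helmholtz_on_def by auto
  then have "(partial True (partial True u) z + partial False (partial False u) z) / 4 = helmholtz_const \<alpha> k * u z"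
    using assms(3) unfolding helmholtz_const_def
    by (simp add: field_simps) (simp add: eq_neg_iff_add_eq_0 algebra_simps)
  then show "dz (dzbar u) z = helmholtz_const \<alpha> k * u z" "dzbar (dz u) z = helmholtz_const \<alpha> k * u z"
    using laplacian_factorisation[OF assms(1) _ assms(4), of u] helmholtz_solution_smooth[OF assms(1,2), of 0]
    by simp_all
qed

text \<open>Commuting \<open>dzbar\<close> inwards past the copies of \<open>dz\<close> reduces step
  by step to the equation for u itself. The total order drops from i + 1 to i - 1.\<close>

lemma dzbar_pure_deriv_pos:
  assumes "open S" "helmholtz_solution S \<alpha> k u" "\<alpha> > 0" "z \<in> S" "i > 0"
  shows "dzbar (pure_deriv i u) z = helmholtz_const \<alpha> k * pure_deriv (i - 1) u z"
proof -
  have "dzbar (pure_deriv (int (Suc n)) u) z = helmholtz_const \<alpha> k * pure_deriv (int n) u z" if "z \<in> S" for n z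
    using that
  proof (induction n arbitrary: z)
    case 0
    then show ?case using helmholtz_dz_dzbar(2)[OF assms(1-3)] dz_pure_deriv[of 0 u] by simp
  next
    case (Suc n)
    let ?v = "pure_deriv (int (Suc n)) u"
    note sm = helmholtz_solution_smooth[OF assms(1,2)]
    have "pure_deriv (int (Suc (Suc n))) u = dz ?v"
      using dz_pure_deriv[of "int (Suc n)" u] by (simp add: add.commute)
    then have "dzbar (pure_deriv (int (Suc (Suc n))) u) z = dz (dzbar ?v) z"
      using dzbar_dz_commute[OF assms(1) sm Suc.prems] by (simp only:)
    also have "\<dots> = dz (\<lambda>z. helmholtz_const \<alpha> k * pure_deriv (int n) u z) z"
      using assms(1) Suc by (intro dz_cong) auto
    also have "\<dots> = helmholtz_const \<alpha> k * dz (pure_deriv (int n) u) z"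
      using sm Suc.prems by (rule dz_scale)
    also have "dz (pure_deriv (int n) u) = ?v"
      using dz_pure_deriv[of "int n" u] by (simp add: add.commute)
    finally show ?case .
  qed
  from this[OF assms(4), of "nat (i - 1)"] assms(5) show ?thesis by simp
qed

lemma dz_pure_deriv_neg:
  assumes "open S" "helmholtz_solution S \<alpha> k u" "\<alpha> > 0" "z \<in> S" "i < 0"
  shows "dz (pure_deriv i u) z = helmholtz_const \<alpha> k * pure_deriv (i + 1) u z"
proof -
  have "dz (pure_deriv (- int (Suc n)) u) z = helmholtz_const \<alpha> k * pure_deriv (- int n) u z" if "z \<in> S" for n z
    using that
  proof (induction n arbitrary: z)
    case 0
    then show ?case using helmholtz_dz_dzbar(1)[OF assms(1-3)] dzbar_pure_deriv[of 0 u] by simp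
  next
    case (Suc n)
    let ?v = "pure_deriv (- int (Suc n)) u"
    note sm = helmholtz_solution_smooth[OF assms(1,2)]
    have "pure_deriv (- int (Suc (Suc n))) u = dzbar ?v"
      using dzbar_pure_deriv[of "- int (Suc n)" u] by (simp add: algebra_simps)
    then have "dz (pure_deriv (- int (Suc (Suc n))) u) z = dzbar (dz ?v) z"
      using dzbar_dz_commute[OF assms(1) sm Suc.prems] by (simp only:)
    also have "\<dots> = dzbar (\<lambda>z. helmholtz_const \<alpha> k * pure_deriv (- int n) u z) z"
      using assms(1) Suc by (intro dzbar_cong) auto
    also have "\<dots> = helmholtz_const \<alpha> k * dzbar (pure_deriv (- int n) u) z"
      using sm Suc.prems by (rule dzbar_scale)
    also have "dzbar (pure_deriv (- int n) u) = ?v"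
      using dzbar_pure_deriv[of "- int n" u] by (simp add: minus_diff_commute)
    finally show ?case .
  qed
  from this[OF assms(4), of "nat (- i - 1)"] assms(5) show ?thesis by (simp add: add.commute)
qed

section \<open>The exterior near a boundary point\<close>

locale jordan_domain =
  fixes D :: "complex set" and \<gamma> :: "real \<Rightarrow> complex" and L :: real
  assumes bounded_D: "bounded D"
    and L_pos: "L > 0"
    and smooth_\<gamma>: "smooth_real_fun \<gamma>"
    and periodic: "\<gamma> (s + L) = \<gamma> s"
    and unit_speed: "norm (vector_derivative \<gamma> (at s)) = 1"
    and inj_\<gamma>: "inj_on \<gamma> {0..<L}"
    and image_\<gamma>: "\<gamma> ` {0..L} = frontier D"
begin

section \<open>The parametrization modulo its period\<close>

definition tangent :: "real \<Rightarrow> complex" where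
  "tangent = hder 1 \<gamma>"

lemma tangent_eq: "tangent s = vector_derivative \<gamma> (at s)"
  by (simp add: tangent_def)

lemma norm_tangent [simp]: "norm (tangent s) = 1"
  by (simp add: tangent_eq unit_speed)

lemma hder_\<gamma>_has_vector_derivative: "(hder n \<gamma> has_vector_derivative hder (Suc n) \<gamma> s) (at s)"
  using smooth_\<gamma> by (simp add: smooth_real_fun_def vector_derivative_works)

lemma \<gamma>_has_vector_derivative: "(\<gamma> has_vector_derivative tangent s) (at s)"
  using hder_\<gamma>_has_vector_derivative[of 0 s] by (simp add: tangent_def)

lemma continuous_on_hder_\<gamma>: "continuous_on A (hder n \<gamma>)"
  by (meson hder_\<gamma>_has_vector_derivative has_vector_derivative_continuous continuous_at_imp_continuous_on)

lemma continuous_on_\<gamma>: "continuous_on A \<gamma>"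
  using continuous_on_hder_\<gamma>[of A 0] by simp

lemma continuous_on_tangent: "continuous_on A tangent"
  using continuous_on_hder_\<gamma>[of A 1] by (simp only: tangent_def)

lemma periodic_int: "\<gamma> (s + of_int m * L) = \<gamma> s"
proof -
  have nat: "\<gamma> (s + of_nat n * L) = \<gamma> s" for n s
  proof (induction n)
    case (Suc n)
    have "\<gamma> (s + of_nat (Suc n) * L) = \<gamma> ((s + of_nat n * L) + L)" by (simp add: algebra_simps)
    then show ?case using Suc periodic by simp
  qed simp
  show ?thesis
  proof (cases m rule: int_cases2)
    case (nonneg n)
    then show ?thesis using nat by simp
  next
    case (nonpos n)
    then show ?thesis using nat[of "s + of_int m * L" n] by simp
  qed
qed

lemma reduce_mod_L: obtains m :: int where "s + of_int m * L \<in> {0..<L}"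
proof -
  have "of_int \<lfloor>s / L\<rfloor> * L \<le> s" "s < (of_int \<lfloor>s / L\<rfloor> + 1) * L"
    using L_pos of_int_floor_le[of "s / L"] real_of_int_floor_add_one_gt[of "s / L"]
    by (simp_all only: pos_le_divide_eq pos_divide_less_eq)
  then have "s + of_int (- \<lfloor>s / L\<rfloor>) * L \<in> {0..<L}" by (auto simp: algebra_simps)
  then show thesis by (rule that)
qed

lemma \<gamma>_in_frontier: "\<gamma> s \<in> frontier D"
proof -
  obtain m where m: "s + of_int m * L \<in> {0..<L}" by (rule reduce_mod_L)
  then have "\<gamma> (s + of_int m * L) \<in> frontier D" using image_\<gamma> by (auto simp flip: image_\<gamma>)
  then show ?thesis by (simp add: periodic_int)
qed

text \<open>Equal points have equal residues modulo L, so their parameters differ by an integer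
  multiple of L, and the bound leaves only the multiple zero.\<close>

lemma \<gamma>_inj_short:
  assumes "\<gamma> s = \<gamma> t" "\<bar>s - t\<bar> < L"
  shows "s = t"
proof -
  obtain m where m: "s + of_int m * L \<in> {0..<L}" by (rule reduce_mod_L)
  obtain n where n: "t + of_int n * L \<in> {0..<L}" by (rule reduce_mod_L)
  have "s + of_int m * L = t + of_int n * L"
    using inj_onD[OF inj_\<gamma> _ m n] assms(1) by (simp add: periodic_int)
  then have eq: "s - t = of_int (n - m) * L" by (simp add: algebra_simps)
  then have "\<bar>of_int (n - m)\<bar> * L < 1 * L" using assms(2) L_pos by (simp add: abs_mult)
  then have "\<bar>real_of_int (n - m)\<bar> < 1" using L_pos by (simp only: mult_less_cancel_right_pos)
  then have "n - m = 0" by linarith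
  then show ?thesis using eq by simp
qed

lemma frontier_parameter:
  assumes "p \<in> frontier D"
  obtains t where "\<bar>t - s\<bar> \<le> L / 2" "\<gamma> t = p"
proof -
  obtain u where u: "p = \<gamma> u" using assms image_\<gamma> by auto
  define m where "m = round ((s - u) / L)"
  have "\<bar>of_int m - (s - u) / L\<bar> \<le> 1 / 2" unfolding m_def by (rule of_int_round_abs_le)
  then have "\<bar>of_int m - (s - u) / L\<bar> * L \<le> 1 / 2 * L" using L_pos by (intro mult_right_mono) auto
  also have "\<bar>of_int m - (s - u) / L\<bar> * L = \<bar>(of_int m - (s - u) / L) * L\<bar>" using L_pos by (simp add: abs_mult)
  also have "(of_int m - (s - u) / L) * L = u + of_int m * L - s" using L_pos by (simp add: field_simps)
  finally show thesis using u by (intro that[of "u + of_int m * L"]) (auto simp: periodic_int)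
qed

text \<open>The parameters within half a period of s but at least \<delta> away form a compact set
  whose image misses \<gamma> s and hence keeps a positive distance. This keeps distant arcs of the
  curve out of a neighbourhood of \<gamma> s.\<close>

lemma frontier_parameter_near:
  assumes "\<delta> > 0"
  obtains \<rho> where "\<rho> > 0"
    "\<And>p. p \<in> frontier D \<Longrightarrow> dist (\<gamma> s) p < \<rho> \<Longrightarrow> \<exists>t. \<bar>t - s\<bar> < \<delta> \<and> \<gamma> t = p"
proof -
  let ?K = "cball s (L / 2) - ball s \<delta>"
  have "compact ?K" by (intro compact_diff compact_cball open_ball)
  then have closed: "closed (\<gamma> ` ?K)"
    by (intro compact_imp_closed compact_continuous_image continuous_on_\<gamma>)
  have "\<gamma> s \<notin> \<gamma> ` ?K"
  proof
    assume "\<gamma> s \<in> \<gamma> ` ?K"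
    then obtain t where t: "t \<in> ?K" "\<gamma> s = \<gamma> t" by auto
    then have "s = t" using L_pos by (intro \<gamma>_inj_short) (auto simp: dist_real_def)
    then show False using t assms by simp
  qed
  from separate_point_closed[OF closed this]
  obtain \<rho> where \<rho>: "\<rho> > 0" "\<And>x. x \<in> \<gamma> ` ?K \<Longrightarrow> \<rho> \<le> dist (\<gamma> s) x"
    by auto
  show thesis
  proof (rule that[OF \<rho>(1)])
    fix p assume p: "p \<in> frontier D" "dist (\<gamma> s) p < \<rho>"
    obtain t where t: "\<bar>t - s\<bar> \<le> L / 2" "\<gamma> t = p" using frontier_parameter[OF p(1)] .
    have "t \<notin> ?K"
    proof
      assume "t \<in> ?K"
      then have "\<rho> \<le> dist (\<gamma> s) (\<gamma> t)" by (intro \<rho>(2) imageI)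
      with p(2) t(2) show False by simp
    qed
    then show "\<exists>t. \<bar>t - s\<bar> < \<delta> \<and> \<gamma> t = p"
      using t by (intro exI[of _ t]) (auto simp: dist_real_def abs_minus_commute)
  qed
qed

text \<open>Unit vectors at distance below 1 have positive inner product, and continuity puts both
  tangents within 1/2 of the one at s.\<close>

lemma tangent_nearly_constant:
  obtains \<delta> where "\<delta> > 0"
    "\<And>x y. \<bar>x - s\<bar> < \<delta> \<Longrightarrow> \<bar>y - s\<bar> < \<delta> \<Longrightarrow> tangent x \<bullet> tangent y > 0"
proof -
  have "isCont tangent s" using continuous_on_tangent[of UNIV] by (simp add: continuous_on_eq_continuous_at)
  then obtain \<delta> where \<delta>: "\<delta> > 0" "\<And>x. dist x s < \<delta> \<Longrightarrow> dist (tangent x) (tangent s) < 1 / 2"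
    unfolding continuous_at_eps_delta by (metis half_gt_zero zero_less_one)
  show thesis
  proof (rule that[OF \<delta>(1)])
    fix x y assume xy: "\<bar>x - s\<bar> < \<delta>" "\<bar>y - s\<bar> < \<delta>"
    have "dist (tangent x) (tangent y) < 1"
      using \<delta>(2)[of x] \<delta>(2)[of y] xy dist_triangle_half_l[of "tangent x" "tangent s" 1 "tangent y"]
      by (simp add: dist_real_def dist_commute)
    then have "(norm (tangent x - tangent y))\<^sup>2 < 1\<^sup>2"
      unfolding dist_norm by (intro power_strict_mono) auto
    then show "tangent x \<bullet> tangent y > 0" by (simp add: dot_norm_neg)
  qed
qed

text \<open>Along the short arc the component in direction \<open>tangent a\<close> strictly
  increases, while it is constant on the normal line at a; so they meet only at the foot
  point.\<close>

lemma normal_line_meets_curve_once: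
  assumes pos: "\<And>x y. \<bar>x - s\<bar> < \<delta> \<Longrightarrow> \<bar>y - s\<bar> < \<delta> \<Longrightarrow> tangent x \<bullet> tangent y > 0"
    and "\<bar>a - s\<bar> < \<delta>" "\<bar>t - s\<bar> < \<delta>" "\<nu> \<in> {\<i>, - \<i>}"
    and eq: "\<gamma> t = \<gamma> a + of_real \<eta> * (\<nu> * tangent a)"
  shows "\<eta> = 0"
proof -
  define g where "g = (\<lambda>x. (\<gamma> x - \<gamma> a) \<bullet> tangent a)"
  have dg: "(g has_real_derivative tangent x \<bullet> tangent a) (at x)" for x
  proof -
    have "((\<lambda>x. \<gamma> x - \<gamma> a) has_vector_derivative tangent x) (at x)"
      using \<gamma>_has_vector_derivative by (auto intro!: derivative_eq_intros)
    from bounded_linear.has_vector_derivative[OF bounded_linear_inner_left this]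
    show ?thesis unfolding g_def by (simp add: has_real_derivative_iff_has_vector_derivative)
  qed
  have "g t = 0" using assms(4) by (auto simp: g_def eq inner_complex_def algebra_simps)
  moreover have "g a = 0" by (simp add: g_def)
  moreover have "g x < g y" if "x < y" "\<bar>x - s\<bar> < \<delta>" "\<bar>y - s\<bar> < \<delta>" for x y
  proof (rule DERIV_pos_imp_increasing[OF that(1)])
    fix u assume "x \<le> u" "u \<le> y"
    then have "\<bar>u - s\<bar> < \<delta>" using that(2,3) by linarith
    then show "\<exists>D'. (g has_real_derivative D') (at u) \<and> 0 < D'"
      using dg pos assms(2) by blast
  qed
  ultimately have "t = a" using assms(2,3) by (metis linorder_cases less_irrefl)
  then have "norm (of_real \<eta> * (\<nu> * tangent a)) = 0" using eq by simp
  then show ?thesis using assms(4) by (auto simp: norm_mult)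
qed

text \<open>The unbounded component of the complement of the curve is connected, misses the frontier
  of D and is not contained in the bounded set D, so it is disjoint from D. By the Jordan curve
  theorem its frontier is the whole curve.\<close>

lemma frontier_subset_closure_exterior: "frontier D \<subseteq> closure (exterior D)"
proof -
  define c where "c = (\<lambda>t. \<gamma> (L * t))"
  have image_c: "path_image c = frontier D"
  proof -
    have "(*) L ` {0..1} = {0..L}" using L_pos by simp
    then show ?thesis using image_\<gamma> by (simp add: path_image_def c_def flip: image_image)
  qed
  have "path c" unfolding path_def c_def
    by (intro continuous_on_compose2[OF continuous_on_\<gamma>[of UNIV]] continuous_intros) auto
  moreover have "loop_free c"
    unfolding loop_free_def
  proof (intro ballI impI)
    fix x y :: real assume xy: "x \<in> {0..1}" "y \<in> {0..1}" "c x = c y"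
    show "x = y \<or> x = 0 \<and> y = 1 \<or> x = 1 \<and> y = 0"
    proof (cases "\<bar>x - y\<bar> < 1")
      case True
      then have "L * \<bar>x - y\<bar> < L * 1" using L_pos by (intro mult_strict_left_mono) auto
      then have "\<bar>L * x - L * y\<bar> < L" using L_pos by (simp add: abs_mult flip: right_diff_distrib)
      then have "L * x = L * y" using xy(3) by (intro \<gamma>_inj_short) (auto simp: c_def)
      then show ?thesis using L_pos by simp
    next
      case False
      then show ?thesis using xy by auto
    qed
  qed
  ultimately have "simple_path c" by (simp add: simple_path_def)
  moreover have "pathfinish c = pathstart c"
    using periodic[of 0] by (simp add: pathfinish_def pathstart_def c_def)
  ultimately have J: "connected (outside (frontier D))" "open (outside (frontier D))"
    "\<not> bounded (outside (frontier D))" "frontier (outside (frontier D)) = frontier D"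
    using Jordan_inside_outside[of c] image_c by auto
  have "outside (frontier D) \<inter> D = {}"
  proof (rule ccontr)
    assume "outside (frontier D) \<inter> D \<noteq> {}"
    moreover have "outside (frontier D) - D \<noteq> {}"
      using J(3) bounded_D bounded_subset by blast
    ultimately have "outside (frontier D) \<inter> frontier D \<noteq> {}"
      using connected_Int_frontier[OF J(1)] by blast
    then show False using outside_no_overlap by blast
  qed
  then have "outside (frontier D) \<inter> closure D = {}" using J(2) by (simp add: open_Int_closure_eq_empty)
  then have "outside (frontier D) \<subseteq> exterior D" by (auto simp: exterior_def)
  then have "closure (outside (frontier D)) \<subseteq> closure (exterior D)" by (rule closure_mono)
  then show ?thesis using J(4) by (metis frontier_def Diff_subset subset_trans)
qed

text \<open>A point close to the curve lies on the normal line through the nearest point of the curve.\<close>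

lemma normal_coordinates_cover:
  assumes "\<delta> > 0"
  obtains \<rho> where "\<rho> > 0" "\<And>p. dist (\<gamma> s) p < \<rho> \<Longrightarrow>
      \<exists>t \<eta>. \<bar>t - s\<bar> < \<delta> \<and> \<bar>\<eta>\<bar> < \<delta> \<and> p = \<gamma> t + of_real \<eta> * (\<i> * tangent t)"
proof -
  obtain r where r: "r > 0"
    "\<And>p. p \<in> frontier D \<Longrightarrow> dist (\<gamma> s) p < r \<Longrightarrow> \<exists>t. \<bar>t - s\<bar> < \<delta> \<and> \<gamma> t = p"
    using frontier_parameter_near[OF assms] by blast
  show thesis
  proof (rule that)
    \<comment> \<open>The bound r / 2 keeps the nearest curve point q within r of \<gamma> s,
      because q is no farther from p than \<gamma> s is; the bound \<delta> controls \<eta>.\<close>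
    show "min (r / 2) \<delta> > 0" using r assms by simp
    fix p assume p: "dist (\<gamma> s) p < min (r / 2) \<delta>"
    have ne: "frontier D \<noteq> {}" using \<gamma>_in_frontier by blast
    obtain q where q: "q \<in> frontier D" "\<And>y. y \<in> frontier D \<Longrightarrow> dist p q \<le> dist p y"
      using distance_attains_inf[OF frontier_closed ne] by blast
    have pq: "dist p q \<le> dist (\<gamma> s) p" using q(2)[OF \<gamma>_in_frontier] by (simp add: dist_commute)
    then have "dist (\<gamma> s) q < r" using p dist_triangle[of "\<gamma> s" q p] by simp
    then obtain t where t: "\<bar>t - s\<bar> < \<delta>" "\<gamma> t = q" using r(2)[OF q(1)] by blast
    define f where "f = (\<lambda>x. (p - \<gamma> x) \<bullet> (p - \<gamma> x))"
    have d: "((\<lambda>x. p - \<gamma> x) has_vector_derivative - tangent t) (at t)"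
      using \<gamma>_has_vector_derivative by (auto intro!: derivative_eq_intros)
    have "(f has_derivative (\<lambda>h. (p - \<gamma> t) \<bullet> (h *\<^sub>R - tangent t) + (h *\<^sub>R - tangent t) \<bullet> (p - \<gamma> t))) (at t)"
      unfolding f_def using d[unfolded has_vector_derivative_def]
        by (rule has_derivative_inner[OF _ d[unfolded has_vector_derivative_def]])
    then have "(f has_real_derivative - 2 * ((p - \<gamma> t) \<bullet> tangent t)) (at t)"
      unfolding has_field_derivative_def
      by (rule has_derivative_eq_rhs) (auto simp: inner_commute algebra_simps)
    moreover have "f t \<le> f x" for x
    proof -
      have "dist p (\<gamma> t) \<le> dist p (\<gamma> x)" using q(2)[OF \<gamma>_in_frontier] t(2) by simp
      then have "(norm (p - \<gamma> t))\<^sup>2 \<le> (norm (p - \<gamma> x))\<^sup>2" unfolding dist_norm by (intro power_mono) auto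
      then show ?thesis by (simp add: f_def power2_norm_eq_inner)
    qed
    ultimately have "- 2 * ((p - \<gamma> t) \<bullet> tangent t) = 0"
      by (intro DERIV_local_min[of f _ t 1]) auto
    moreover have "(p - \<gamma> t) \<bullet> tangent t = Re ((p - \<gamma> t) * cnj (tangent t))"
      by (simp add: inner_complex_def)
    ultimately have orth: "Re ((p - \<gamma> t) * cnj (tangent t)) = 0" by linarith
    \<comment> \<open>Multiplication by the conjugate unit tangent passes to local coordinates: the
      real part is the tangential one, which vanishes since the squared distance is stationary at t,
      and the imaginary part is the signed normal one.\<close>
    define \<eta> where "\<eta> = Im ((p - \<gamma> t) * cnj (tangent t))"
    have "(p - \<gamma> t) * cnj (tangent t) = of_real \<eta> * \<i>"
      using orth by (simp add: complex_eq_iff \<eta>_def)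
    then have "(p - \<gamma> t) * cnj (tangent t) * tangent t = of_real \<eta> * \<i> * tangent t" by simp
    moreover have "cnj (tangent t) * tangent t = 1"
      using complex_norm_square[of "tangent t"] by (simp add: mult.commute)
    ultimately have *: "p - \<gamma> t = of_real \<eta> * (\<i> * tangent t)" by (simp add: mult.assoc)
    then have "norm (p - \<gamma> t) = \<bar>\<eta>\<bar>" by (simp add: norm_mult)
    then have "\<bar>\<eta>\<bar> < \<delta>" using pq p t(2) by (simp add: dist_norm)
    then show "\<exists>t \<eta>. \<bar>t - s\<bar> < \<delta> \<and> \<bar>\<eta>\<bar> < \<delta> \<and> p = \<gamma> t + of_real \<eta> * (\<i> * tangent t)"
      using t * by (intro exI[of _ t] exI[of _ \<eta>]) (auto simp: algebra_simps)
  qed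
qed

section \<open>One-sided strips along the curve\<close>

definition side :: "complex \<Rightarrow> real \<Rightarrow> real \<Rightarrow> complex set" where
  "side \<nu> s \<delta> = (\<lambda>(x, \<eta>). \<gamma> x + of_real \<eta> * (\<nu> * tangent x)) ` ({s - \<delta><..<s + \<delta>} \<times> {0<..<\<delta>})"

lemma sideE:
  assumes "p \<in> side \<nu> s \<delta>"
  obtains x \<eta> where "\<bar>x - s\<bar> < \<delta>" "0 < \<eta>" "\<eta> < \<delta>" "p = \<gamma> x + of_real \<eta> * (\<nu> * tangent x)"
proof -
  from assms obtain q where "p = (\<lambda>(x, \<eta>). \<gamma> x + of_real \<eta> * (\<nu> * tangent x)) q"
    "q \<in> {s - \<delta><..<s + \<delta>} \<times> {0<..<\<delta>}"
    unfolding side_def by (rule imageE)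
  then show thesis by (intro that[of "fst q" "snd q"]) (auto simp: abs_less_iff)
qed

lemma connected_side: "connected (side \<nu> s \<delta>)"
proof -
  have "continuous_on ({s - \<delta><..<s + \<delta>} \<times> {0<..<\<delta>}) (\<lambda>(x, \<eta>). \<gamma> x + of_real \<eta> * (\<nu> * tangent x))"
    unfolding case_prod_unfold
    by (intro continuous_intros continuous_on_compose2[OF continuous_on_\<gamma>[of UNIV]]
        continuous_on_compose2[OF continuous_on_tangent[of UNIV]]) auto
  moreover have "connected ({s - \<delta><..<s + \<delta>} \<times> {0<..<\<delta>})"
    by (intro connected_Times) auto
  ultimately show ?thesis unfolding side_def by (rule connected_continuous_image)
qed

text \<open>A curve point in a thin strip is close to \<gamma> s, hence on the short arc, and there
  the normal line through a foot point meets the curve at height 0 only.\<close>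

lemma side_disjoint_frontier:
  obtains \<delta> where "\<delta> > 0" "\<And>\<nu>. \<nu> \<in> {\<i>, - \<i>} \<Longrightarrow> side \<nu> s \<delta> \<inter> frontier D = {}"
proof -
  obtain d where d: "d > 0"
    "\<And>x y. \<bar>x - s\<bar> < d \<Longrightarrow> \<bar>y - s\<bar> < d \<Longrightarrow> tangent x \<bullet> tangent y > 0"
    using tangent_nearly_constant by blast
  obtain r where r: "r > 0"
    "\<And>p. p \<in> frontier D \<Longrightarrow> dist (\<gamma> s) p < r \<Longrightarrow> \<exists>t. \<bar>t - s\<bar> < d \<and> \<gamma> t = p"
    using frontier_parameter_near[OF d(1)] by blast
  have "isCont \<gamma> s" using continuous_on_\<gamma>[of UNIV] by (simp add: continuous_on_eq_continuous_at)
  then obtain e where e: "e > 0" "\<And>x. dist x s < e \<Longrightarrow> dist (\<gamma> x) (\<gamma> s) < r / 2"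
    unfolding continuous_at_eps_delta using r(1) by (metis half_gt_zero)
  \<comment> \<open>\<open>e\<close> keeps the foot point within r / 2 of \<gamma> s and the height
    adds less than r / 2; \<open>d\<close> keeps the tangents nearly parallel.\<close>
  define M where "M = min (min d e) (r / 2)"
  show thesis
  proof (rule that)
    show "M > 0" using d e r by (simp add: M_def)
    fix \<nu> assume \<nu>: "\<nu> \<in> {\<i>, - \<i>}"
    show "side \<nu> s M \<inter> frontier D = {}"
    proof (rule ccontr)
      assume "side \<nu> s M \<inter> frontier D \<noteq> {}"
      then obtain p where "p \<in> side \<nu> s M" "p \<in> frontier D" by blast
      then obtain x \<eta> where "\<bar>x - s\<bar> < M" "0 < \<eta>" "\<eta> < M"
        and fr: "\<gamma> x + of_real \<eta> * (\<nu> * tangent x) \<in> frontier D" (is "?p \<in> _")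
        by (metis sideE)
      then have x: "\<bar>x - s\<bar> < min d e" and \<eta>: "0 < \<eta>" "\<eta> < r / 2"
        by (auto simp: M_def abs_less_iff)
      have "dist (\<gamma> x) ?p = \<eta>" using \<nu> \<eta> by (auto simp: dist_norm norm_mult)
      moreover have "dist (\<gamma> x) (\<gamma> s) < r / 2" using e(2) x by (simp add: dist_real_def)
      ultimately have "dist (\<gamma> s) ?p < r" using \<eta> dist_triangle[of "\<gamma> s" ?p "\<gamma> x"] by (simp add: dist_commute)
      then obtain t where t: "\<bar>t - s\<bar> < d" "\<gamma> t = ?p" using r(2)[OF fr] by blast
      have "\<eta> = 0" using normal_line_meets_curve_once[OF d(2) _ t(1) \<nu> t(2)] x by simp
      then show False using \<eta> by simp
    qed
  qed
qed

lemma side_dichotomy: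
  assumes "side \<nu> s \<delta> \<inter> frontier D = {}"
  shows "side \<nu> s \<delta> \<subseteq> D \<or> side \<nu> s \<delta> \<subseteq> exterior D"
proof (cases "side \<nu> s \<delta> \<inter> D = {}")
  case True
  then show ?thesis using assms closure_Un_frontier[of D] by (auto simp: exterior_def)
next
  case False
  then show ?thesis using connected_Int_frontier[OF connected_side False] assms by blast
qed

text \<open>If both strips lay in D, then together with the arc between them they would cover a ball
  about \<gamma> s by the closure of D, although \<gamma> s is a limit of exterior points.\<close>

lemma side_exterior:
  assumes "\<delta> > 0" "side \<i> s \<delta> \<inter> frontier D = {}" "side (- \<i>) s \<delta> \<inter> frontier D = {}"
  shows "side \<i> s \<delta> \<subseteq> exterior D \<or> side (- \<i>) s \<delta> \<subseteq> exterior D"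
proof (rule ccontr)
  assume "\<not> ?thesis"
  then have D: "side \<i> s \<delta> \<subseteq> D" "side (- \<i>) s \<delta> \<subseteq> D"
    using side_dichotomy assms by blast+
  obtain \<rho> where \<rho>: "\<rho> > 0" "\<And>p. dist (\<gamma> s) p < \<rho> \<Longrightarrow>
      \<exists>t \<eta>. \<bar>t - s\<bar> < \<delta> \<and> \<bar>\<eta>\<bar> < \<delta> \<and> p = \<gamma> t + of_real \<eta> * (\<i> * tangent t)"
    using normal_coordinates_cover[OF assms(1)] by blast
  have "p \<in> closure D" if p: "dist (\<gamma> s) p < \<rho>" for p
  proof -
    obtain t \<eta> where t: "\<bar>t - s\<bar> < \<delta>" "\<bar>\<eta>\<bar> < \<delta>" "p = \<gamma> t + of_real \<eta> * (\<i> * tangent t)"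
      using \<rho>(2)[OF p] by blast
    consider "\<eta> = 0" | "\<eta> > 0" | "\<eta> < 0" by linarith
    then show ?thesis
    proof cases
      case 1
      then show ?thesis using t \<gamma>_in_frontier[of t] by (simp add: frontier_def)
    next
      case 2
      then have "p \<in> side \<i> s \<delta>" using t unfolding side_def
        by (intro image_eqI[of _ _ "(t, \<eta>)"]) (auto simp: abs_less_iff)
      then show ?thesis using D closure_subset by blast
    next
      case 3
      then have "p \<in> side (- \<i>) s \<delta>" using t unfolding side_def
        by (intro image_eqI[of _ _ "(t, - \<eta>)"]) (auto simp: abs_less_iff)
      then show ?thesis using D closure_subset by blast
    qed
  qed
  then have "ball (\<gamma> s) \<rho> \<inter> exterior D = {}" by (auto simp: exterior_def)
  then have "ball (\<gamma> s) \<rho> \<inter> closure (exterior D) = {}" by (simp add: open_Int_closure_eq_empty)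
  moreover have "\<gamma> s \<in> closure (exterior D)"
    using frontier_subset_closure_exterior \<gamma>_in_frontier by blast
  ultimately have "\<gamma> s \<notin> ball (\<gamma> s) \<rho>" by blast
  then show False using \<rho>(1) by simp
qed

text \<open>\<open>out_normal\<close> tests the side \<open>- \<i>\<close> and otherwise defaults to
  \<open>\<i>\<close>. Each strip lies entirely in D or in the exterior, so the test has the same
  outcome at all nearby parameters, and when it fails the default side is exterior.\<close>

lemma out_normal_locally:
  obtains \<nu> \<delta> where "\<nu> \<in> {\<i>, - \<i>}" "\<delta> > 0"
    "\<And>x. \<bar>x - s\<bar> < \<delta> \<Longrightarrow> out_normal D \<gamma> x = \<nu> * tangent x"
    "\<And>x \<eta>. \<bar>x - s\<bar> < \<delta> \<Longrightarrow> 0 < \<eta> \<Longrightarrow> \<eta> < \<delta> \<Longrightarrow> \<gamma> x + of_real \<eta> * (\<nu> * tangent x) \<in> exterior D"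
proof -
  obtain \<delta> where \<delta>: "\<delta> > 0" "\<And>\<nu>. \<nu> \<in> {\<i>, - \<i>} \<Longrightarrow> side \<nu> s \<delta> \<inter> frontier D = {}"
    using side_disjoint_frontier by blast
  have mem: "\<gamma> x + of_real \<eta> * (\<nu> * tangent x) \<in> side \<nu> s \<delta>"
    if "\<bar>x - s\<bar> < \<delta>" "0 < \<eta>" "\<eta> < \<delta>" for x \<eta> \<nu>
    unfolding side_def using that by (intro image_eqI[of _ _ "(x, \<eta>)"]) (auto simp: abs_less_iff)
  have small: "\<forall>\<^sub>F \<eta> in at_right (0::real). 0 < \<eta> \<and> \<eta> < \<delta>"
    using \<delta>(1) by (auto simp: eventually_at_right intro!: exI[of _ \<delta>])
  show thesis
  proof (cases "side (- \<i>) s \<delta> \<subseteq> exterior D")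
    case True
    show thesis
    proof (rule that[of "- \<i>", OF _ \<delta>(1)])
      fix x assume x: "\<bar>x - s\<bar> < \<delta>"
      have "\<forall>\<^sub>F \<eta> in at_right 0. \<gamma> x + of_real \<eta> * (- \<i> * vector_derivative \<gamma> (at x)) \<in> exterior D"
        using small by eventually_elim (use mem[OF x, of _ "- \<i>"] True in \<open>auto simp: tangent_eq\<close>)
      then show "out_normal D \<gamma> x = - \<i> * tangent x" by (simp add: out_normal_def tangent_eq)
    qed (insert mem[where \<nu> = "- \<i>"] True, blast+)
  next
    case False
    then have ext: "side \<i> s \<delta> \<subseteq> exterior D" using side_exterior \<delta> by blast
    have int: "side (- \<i>) s \<delta> \<subseteq> D" using False side_dichotomy \<delta>(2) by blast
    show thesis
    proof (rule that[of \<i>, OF _ \<delta>(1)])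
      fix x assume x: "\<bar>x - s\<bar> < \<delta>"
      have "\<not> (\<forall>\<^sub>F \<eta> in at_right 0. \<gamma> x + of_real \<eta> * (- \<i> * vector_derivative \<gamma> (at x)) \<in> exterior D)"
      proof
        assume "\<forall>\<^sub>F \<eta> in at_right 0. \<gamma> x + of_real \<eta> * (- \<i> * vector_derivative \<gamma> (at x)) \<in> exterior D"
        then have "\<forall>\<^sub>F \<eta> in at_right (0::real). False"
          using small
        proof eventually_elim
          case (elim \<eta>)
          then have "\<gamma> x + of_real \<eta> * (- \<i> * tangent x) \<in> D" using mem[OF x, of \<eta> "- \<i>"] int by auto
          with elim show ?case using closure_subset by (auto simp: exterior_def tangent_eq)
        qed
        then show False by (simp add: eventually_False)
      qed
      then show "out_normal D \<gamma> x = \<i> * tangent x" by (simp add: out_normal_def tangent_eq)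
    qed (insert mem[where \<nu> = \<i>] ext, blast+)
  qed
qed

end

section \<open>Derivatives in boundary coordinates\<close>

text \<open>\<open>hder\<close> adds derivatives on the outside; splitting off the innermost one
  turns tangential derivatives of u into those of its first derivative.\<close>

lemma hder_Suc_shift: "hder (Suc n) f = hder n (hder 1 f)"
  by (induction n) auto

text \<open>The situation near a fixed parameter \<open>s\<^sub>0\<close>: a single rotation \<nu>
  is valid on a whole strip, so the normal can be differentiated along the curve.\<close>

locale normal_tube = jordan_domain +
  fixes s\<^sub>0 :: real and \<nu> :: complex and \<delta> \<alpha> k :: real
  assumes \<nu>: "\<nu> \<in> {\<i>, - \<i>}" and \<delta>_pos: "\<delta> > 0" and \<alpha>_pos: "\<alpha> > 0"
    and out_normal_eq: "\<bar>x - s\<^sub>0\<bar> < \<delta> \<Longrightarrow> out_normal D \<gamma> x = \<nu> * tangent x"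
    and in_exterior: "\<bar>x - s\<^sub>0\<bar> < \<delta> \<Longrightarrow> 0 < \<eta> \<Longrightarrow> \<eta> < \<delta> \<Longrightarrow>
        \<gamma> x + of_real \<eta> * (\<nu> * tangent x) \<in> exterior D"
begin

definition tube :: "real \<Rightarrow> real \<Rightarrow> complex" where
  "tube x \<eta> = \<gamma> x + of_real \<eta> * (\<nu> * tangent x)"

definition tube_s :: "real \<Rightarrow> real \<Rightarrow> complex" where
  "tube_s x \<eta> = tangent x + of_real \<eta> * (\<nu> * hder 2 \<gamma> x)"

definition tube_domain :: "(real \<times> real) set" where
  "tube_domain = {s\<^sub>0 - \<delta><..<s\<^sub>0 + \<delta>} \<times> {0<..<\<delta>}"

abbreviation solution :: "(complex \<Rightarrow> complex) \<Rightarrow> bool" where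
  "solution \<equiv> helmholtz_solution (exterior D) \<alpha> k"

lemma open_exterior: "open (exterior D)"
  unfolding exterior_def by (intro open_Compl closed_closure)

lemma tube_in_exterior: "(x, \<eta>) \<in> tube_domain \<Longrightarrow> tube x \<eta> \<in> exterior D"
  unfolding tube_def by (rule in_exterior) (auto simp: tube_domain_def abs_less_iff)

lemma bcoord_eq: "x \<in> {s\<^sub>0 - \<delta><..<s\<^sub>0 + \<delta>} \<Longrightarrow> bcoord D \<gamma> u x \<eta> = u (tube x \<eta>)"
  unfolding bcoord_def tube_def by (subst out_normal_eq) (auto simp: abs_less_iff)

lemma tangent_has_vector_derivative: "(tangent has_vector_derivative hder 2 \<gamma> x) (at x)"
  using hder_\<gamma>_has_vector_derivative[of 1 x] by (simp add: tangent_def numeral_2_eq_2)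

lemma tube_has_vector_derivative_s: "((\<lambda>x. tube x \<eta>) has_vector_derivative tube_s x \<eta>) (at x)"
  unfolding tube_def tube_s_def
  by (auto intro!: derivative_eq_intros \<gamma>_has_vector_derivative tangent_has_vector_derivative)

lemma tube_has_vector_derivative_\<eta>: "(tube x has_vector_derivative \<nu> * tangent x) (at \<eta>)"
proof -
  have "((\<lambda>\<eta>. of_real \<eta> * (\<nu> * tangent x)) has_vector_derivative \<nu> * tangent x) (at \<eta>)"
    using has_vector_derivative_mult_left[OF has_vector_derivative_of_real[OF DERIV_ident], of "\<nu> * tangent x"]
    by simp
  from has_vector_derivative_add[OF has_vector_derivative_const[of "\<gamma> x"] this]
  show ?thesis by (simp add: tube_def[abs_def])
qed

text \<open>The coefficients of the differential expressions on the boundary strip are taken from an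
  algebra that is closed under both partial derivatives.\<close>

inductive_set coef :: "(real \<Rightarrow> real \<Rightarrow> complex) set" where
  const: "(\<lambda>x \<eta>. c) \<in> coef"
| eta: "(\<lambda>x \<eta>. of_real \<eta>) \<in> coef"
| curve: "(\<lambda>x \<eta>. hder n \<gamma> x) \<in> coef"
| cnj_curve: "(\<lambda>x \<eta>. cnj (hder n \<gamma> x)) \<in> coef"
| add: "f \<in> coef \<Longrightarrow> g \<in> coef \<Longrightarrow> (\<lambda>x \<eta>. f x \<eta> + g x \<eta>) \<in> coef"
| mult: "f \<in> coef \<Longrightarrow> g \<in> coef \<Longrightarrow> (\<lambda>x \<eta>. f x \<eta> * g x \<eta>) \<in> coef"

lemma coef_power: "f \<in> coef \<Longrightarrow> (\<lambda>x \<eta>. f x \<eta> ^ n) \<in> coef"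
  by (induction n) (auto intro: coef.intros)

lemma coef_tangent: "(\<lambda>x \<eta>. tangent x) \<in> coef"
  using coef.curve[of 1] by (simp only: tangent_def)

lemma coef_normal: "(\<lambda>x \<eta>. \<nu> * tangent x) \<in> coef"
  by (intro coef.mult coef.const coef_tangent)

lemma coef_tube_s: "tube_s \<in> coef"
  unfolding tube_s_def by (intro coef.mult coef.add coef.const coef.eta coef.curve coef_tangent)

text \<open>Needed because the chain rule multiplies every \<open>dzbar\<close> term by a conjugate
  velocity.\<close>

lemma coef_cnj: "f \<in> coef \<Longrightarrow> (\<lambda>x \<eta>. cnj (f x \<eta>)) \<in> coef"
  by (induction rule: coef.induct) (auto intro: coef.intros)

lemma coef_deriv_s:
  assumes "f \<in> coef"
  shows "\<exists>f' \<in> coef. \<forall>x \<eta>. ((\<lambda>x. f x \<eta>) has_vector_derivative f' x \<eta>) (at x)"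
  using assms
proof (induction rule: coef.induct)
  case (const c)
  show ?case by (rule bexI[OF _ coef.const[of 0]]) simp
next
  case eta
  show ?case by (rule bexI[OF _ coef.const[of 0]]) simp
next
  case (curve n)
  show ?case 
    by (rule bexI[OF _ coef.curve[of "Suc n"]]) (intro allI hder_\<gamma>_has_vector_derivative)
next
  case (cnj_curve n)
  show ?case 
    by (rule bexI[OF _ coef.cnj_curve[of "Suc n"]])
      (intro allI has_vector_derivative_cnj hder_\<gamma>_has_vector_derivative)
next
  case (add f g)
  then obtain f' g' where f': "f' \<in> coef" "\<And>x \<eta>. ((\<lambda>x. f x \<eta>) has_vector_derivative f' x \<eta>) (at x)"
    and g': "g' \<in> coef" "\<And>x \<eta>. ((\<lambda>x. g x \<eta>) has_vector_derivative g' x \<eta>) (at x)"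
    by blast
  show ?case
    by (rule bexI[OF _ coef.add[OF f'(1) g'(1)]]) (intro allI has_vector_derivative_add f' g')
next
  case (mult f g)
  then obtain f' g' where f': "f' \<in> coef" "\<And>x \<eta>. ((\<lambda>x. f x \<eta>) has_vector_derivative f' x \<eta>) (at x)"
    and g': "g' \<in> coef" "\<And>x \<eta>. ((\<lambda>x. g x \<eta>) has_vector_derivative g' x \<eta>) (at x)"
    by blast
  show ?case
    by (rule bexI[OF _ coef.add[OF coef.mult[OF mult.hyps(1) g'(1)] coef.mult[OF f'(1) mult.hyps(2)]]])
      (intro allI has_vector_derivative_mult f' g')
qed

lemma coef_deriv_\<eta>:
  assumes "f \<in> coef"
  shows "\<exists>f' \<in> coef. \<forall>x \<eta>. ((f x) has_vector_derivative f' x \<eta>) (at \<eta>)"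
  using assms
proof (induction rule: coef.induct)
  case (const c)
  show ?case by (rule bexI[OF _ coef.const[of 0]]) simp
next
  case eta
  have "(of_real has_vector_derivative complex_of_real 1) (at \<eta>)" for \<eta>
    by (intro has_vector_derivative_of_real DERIV_ident)
  then show ?case by (intro bexI[OF _ coef.const[of 1]]) auto
next
  case (curve n)
  show ?case by (rule bexI[OF _ coef.const[of 0]]) simp
next
  case (cnj_curve n)
  show ?case by (rule bexI[OF _ coef.const[of 0]]) simp
next
  case (add f g)
  then obtain f' g' where f': "f' \<in> coef" "\<And>x \<eta>. ((f x) has_vector_derivative f' x \<eta>) (at \<eta>)"
    and g': "g' \<in> coef" "\<And>x \<eta>. ((g x) has_vector_derivative g' x \<eta>) (at \<eta>)"
    by blast
  show ?case
    by (rule bexI[OF _ coef.add[OF f'(1) g'(1)]]) (intro allI has_vector_derivative_add f' g')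
next
  case (mult f g)
  then obtain f' g' where f': "f' \<in> coef" "\<And>x \<eta>. ((f x) has_vector_derivative f' x \<eta>) (at \<eta>)"
    and g': "g' \<in> coef" "\<And>x \<eta>. ((g x) has_vector_derivative g' x \<eta>) (at \<eta>)"
    by blast
  show ?case
    by (rule bexI[OF _ coef.add[OF coef.mult[OF mult.hyps(1) g'(1)] coef.mult[OF f'(1) mult.hyps(2)]]])
      (intro allI has_vector_derivative_mult f' g')
qed

lemma coef_tendsto:
  assumes "f \<in> coef"
  shows "(f x \<longlongrightarrow> f x 0) (at_right 0)"
proof -
  obtain f' where "\<And>x \<eta>. (f x has_vector_derivative f' x \<eta>) (at \<eta>)"
    using coef_deriv_\<eta>[OF assms] by blast
  then have "isCont (f x) 0" by (rule has_vector_derivative_continuous)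
  then show ?thesis by (simp add: continuous_at filterlim_at_split)
qed

text \<open>Moving away from index 0 has factor 1, moving towards it costs one use of the Helmholtz
  equation. With these factors a single chain rule covers all indices.\<close>

definition dz_coef :: "int \<Rightarrow> complex" where
  "dz_coef i = (if 0 \<le> i then 1 else helmholtz_const \<alpha> k)"

definition dzbar_coef :: "int \<Rightarrow> complex" where
  "dzbar_coef i = (if i \<le> 0 then 1 else helmholtz_const \<alpha> k)"

lemma pure_deriv_compose:
  assumes "solution u" "g t \<in> exterior D" "(g has_vector_derivative g') (at t)"
  shows "((\<lambda>t. pure_deriv i u (g t)) has_vector_derivative
      g' * (dz_coef i * pure_deriv (i + 1) u (g t)) +
      cnj g' * (dzbar_coef i * pure_deriv (i - 1) u (g t))) (at t)"
proof -
  have "dz (pure_deriv i u) (g t) = dz_coef i * pure_deriv (i + 1) u (g t)"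
    using dz_pure_deriv[of i u] dz_pure_deriv_neg[OF open_exterior assms(1) \<alpha>_pos assms(2), of i]
    by (simp add: dz_coef_def)
  moreover have "dzbar (pure_deriv i u) (g t) = dzbar_coef i * pure_deriv (i - 1) u (g t)"
    using dzbar_pure_deriv[of i u] dzbar_pure_deriv_pos[OF open_exterior assms(1) \<alpha>_pos assms(2), of i]
    by (simp add: dzbar_coef_def)
  ultimately show ?thesis
    using smooth_on_has_vector_derivative_compose[OF open_exterior
        helmholtz_solution_smooth[OF open_exterior assms(1)] assms(2,3), of i] by simp
qed

text \<open>Differential expressions of order less than \<open>m\<close>, uniformly in the solution \<open>u\<close>.\<close>

inductive_set expr :: "nat \<Rightarrow> ((complex \<Rightarrow> complex) \<Rightarrow> real \<Rightarrow> real \<Rightarrow> complex) set" for m where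
  zero: "(\<lambda>u x \<eta>. 0) \<in> expr m"
| pure: "c \<in> coef \<Longrightarrow> \<bar>i\<bar> < int m \<Longrightarrow> (\<lambda>u x \<eta>. c x \<eta> * pure_deriv i u (tube x \<eta>)) \<in> expr m"
| add: "e \<in> expr m \<Longrightarrow> f \<in> expr m \<Longrightarrow> (\<lambda>u x \<eta>. e u x \<eta> + f u x \<eta>) \<in> expr m"

text \<open>The contributions with index i + 1, i - 1 and i are kept apart, so that a leading
  coefficient can be read off later.\<close>

lemma term_deriv_s:
  assumes "c \<in> coef"
  obtains c' where "c' \<in> coef" "\<And>u x \<eta>. solution u \<Longrightarrow> (x, \<eta>) \<in> tube_domain \<Longrightarrow>
    ((\<lambda>x. c x \<eta> * pure_deriv i u (tube x \<eta>)) has_vector_derivative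
      (c x \<eta> * tube_s x \<eta> * dz_coef i) * pure_deriv (i + 1) u (tube x \<eta>) +
      (c x \<eta> * cnj (tube_s x \<eta>) * dzbar_coef i) * pure_deriv (i - 1) u (tube x \<eta>) +
      c' x \<eta> * pure_deriv i u (tube x \<eta>)) (at x)"
proof -
  obtain c' where c': "c' \<in> coef" "\<And>x \<eta>. ((\<lambda>x. c x \<eta>) has_vector_derivative c' x \<eta>) (at x)"
    using coef_deriv_s[OF assms] by blast
  show thesis
  proof (rule that[OF c'(1)])
    fix u x \<eta> assume *: "solution u" "(x, \<eta>) \<in> tube_domain"
    note d = pure_deriv_compose[OF *(1) tube_in_exterior[OF *(2)] tube_has_vector_derivative_s, of i]
    show "((\<lambda>x. c x \<eta> * pure_deriv i u (tube x \<eta>)) has_vector_derivative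
      (c x \<eta> * tube_s x \<eta> * dz_coef i) * pure_deriv (i + 1) u (tube x \<eta>) +
      (c x \<eta> * cnj (tube_s x \<eta>) * dzbar_coef i) * pure_deriv (i - 1) u (tube x \<eta>) +
      c' x \<eta> * pure_deriv i u (tube x \<eta>)) (at x)"
      by (rule has_vector_derivative_eq_rhs[OF has_vector_derivative_mult[OF c'(2) d]])
        (simp add: algebra_simps)
  qed
qed

lemma term_deriv_\<eta>:
  assumes "c \<in> coef"
  obtains c' where "c' \<in> coef" "\<And>u x \<eta>. solution u \<Longrightarrow> (x, \<eta>) \<in> tube_domain \<Longrightarrow>
    ((\<lambda>\<eta>. c x \<eta> * pure_deriv i u (tube x \<eta>)) has_vector_derivative
      (c x \<eta> * (\<nu> * tangent x) * dz_coef i) * pure_deriv (i + 1) u (tube x \<eta>) +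
      (c x \<eta> * cnj (\<nu> * tangent x) * dzbar_coef i) * pure_deriv (i - 1) u (tube x \<eta>) +
      c' x \<eta> * pure_deriv i u (tube x \<eta>)) (at \<eta>)"
proof -
  obtain c' where c': "c' \<in> coef" "\<And>x \<eta>. (c x has_vector_derivative c' x \<eta>) (at \<eta>)"
    using coef_deriv_\<eta>[OF assms] by blast
  show thesis
  proof (rule that[OF c'(1)])
    fix u x \<eta> assume *: "solution u" "(x, \<eta>) \<in> tube_domain"
    note d = pure_deriv_compose[OF *(1) tube_in_exterior[OF *(2)] tube_has_vector_derivative_\<eta>, of i]
    show "((\<lambda>\<eta>. c x \<eta> * pure_deriv i u (tube x \<eta>)) has_vector_derivative
      (c x \<eta> * (\<nu> * tangent x) * dz_coef i) * pure_deriv (i + 1) u (tube x \<eta>) +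
      (c x \<eta> * cnj (\<nu> * tangent x) * dzbar_coef i) * pure_deriv (i - 1) u (tube x \<eta>) +
      c' x \<eta> * pure_deriv i u (tube x \<eta>)) (at \<eta>)"
      by (rule has_vector_derivative_eq_rhs[OF has_vector_derivative_mult[OF c'(2) d]])
        (simp add: algebra_simps)
  qed
qed

lemma expr_deriv_s:
  assumes "e \<in> expr m"
  shows "\<exists>e' \<in> expr (Suc m). \<forall>u x \<eta>. solution u \<longrightarrow> (x, \<eta>) \<in> tube_domain \<longrightarrow>
    ((\<lambda>x. e u x \<eta>) has_vector_derivative e' u x \<eta>) (at x)"
  using assms
proof (induction rule: expr.induct)
  case zero
  show ?case by (rule bexI[OF _ expr.zero]) simp
next
  case (pure c i)
  obtain c' where c': "c' \<in> coef" "\<And>u x \<eta>. solution u \<Longrightarrow> (x, \<eta>) \<in> tube_domain \<Longrightarrow>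
    ((\<lambda>x. c x \<eta> * pure_deriv i u (tube x \<eta>)) has_vector_derivative
      (c x \<eta> * tube_s x \<eta> * dz_coef i) * pure_deriv (i + 1) u (tube x \<eta>) +
      (c x \<eta> * cnj (tube_s x \<eta>) * dzbar_coef i) * pure_deriv (i - 1) u (tube x \<eta>) +
      c' x \<eta> * pure_deriv i u (tube x \<eta>)) (at x)"
    using term_deriv_s[OF pure.hyps(1), of i] by blast
  show ?case
    by (rule bexI, intro allI impI, erule (1) c'(2))
      (use pure.hyps in \<open>auto intro!: expr.intros coef.mult coef.const coef_tube_s coef_cnj c'(1)\<close>)
next
  case (add e f)
  then obtain e' f' where e': "e' \<in> expr (Suc m)" "\<And>u x \<eta>. solution u \<Longrightarrow> (x, \<eta>) \<in> tube_domain \<Longrightarrow>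
      ((\<lambda>x. e u x \<eta>) has_vector_derivative e' u x \<eta>) (at x)"
    and f': "f' \<in> expr (Suc m)" "\<And>u x \<eta>. solution u \<Longrightarrow> (x, \<eta>) \<in> tube_domain \<Longrightarrow>
      ((\<lambda>x. f u x \<eta>) has_vector_derivative f' u x \<eta>) (at x)"
    by blast
  show ?case
    by (rule bexI[OF _ expr.add[OF e'(1) f'(1)]]) (intro allI impI has_vector_derivative_add e' f')
qed

lemma expr_deriv_\<eta>:
  assumes "e \<in> expr m"
  shows "\<exists>e' \<in> expr (Suc m). \<forall>u x \<eta>. solution u \<longrightarrow> (x, \<eta>) \<in> tube_domain \<longrightarrow>
    (e u x has_vector_derivative e' u x \<eta>) (at \<eta>)"
  using assms
proof (induction rule: expr.induct)
  case zero
  show ?case by (rule bexI[OF _ expr.zero]) simp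
next
  case (pure c i)
  obtain c' where c': "c' \<in> coef" "\<And>u x \<eta>. solution u \<Longrightarrow> (x, \<eta>) \<in> tube_domain \<Longrightarrow>
    ((\<lambda>\<eta>. c x \<eta> * pure_deriv i u (tube x \<eta>)) has_vector_derivative
      (c x \<eta> * (\<nu> * tangent x) * dz_coef i) * pure_deriv (i + 1) u (tube x \<eta>) +
      (c x \<eta> * cnj (\<nu> * tangent x) * dzbar_coef i) * pure_deriv (i - 1) u (tube x \<eta>) +
      c' x \<eta> * pure_deriv i u (tube x \<eta>)) (at \<eta>)"
    using term_deriv_\<eta>[OF pure.hyps(1), of i] by blast
  show ?case
    by (rule bexI, intro allI impI, erule (1) c'(2))
      (use pure.hyps in \<open>auto intro!: expr.intros coef.mult coef.const coef_normal coef_cnj c'(1)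
         simp del: complex_cnj_mult\<close>)
next
  case (add e f)
  then obtain e' f' where e': "e' \<in> expr (Suc m)" "\<And>u x \<eta>. solution u \<Longrightarrow> (x, \<eta>) \<in> tube_domain \<Longrightarrow>
      (e u x has_vector_derivative e' u x \<eta>) (at \<eta>)"
    and f': "f' \<in> expr (Suc m)" "\<And>u x \<eta>. solution u \<Longrightarrow> (x, \<eta>) \<in> tube_domain \<Longrightarrow>
      (f u x has_vector_derivative f' u x \<eta>) (at \<eta>)"
    by blast
  show ?case
    by (rule bexI[OF _ expr.add[OF e'(1) f'(1)]]) (intro allI impI has_vector_derivative_add e' f')
qed

text \<open>The two extreme indices move outward with factor 1, multiplied by the velocity and its
  conjugate; all other contributions have index at most m in absolute value and join the
  remainder.\<close>

lemma leading_deriv_s: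
  assumes "p \<in> coef" "q \<in> coef" "e \<in> expr m" "m > 0"
  obtains e' where "e' \<in> expr (Suc m)" "\<And>u x \<eta>. solution u \<Longrightarrow> (x, \<eta>) \<in> tube_domain \<Longrightarrow>
    ((\<lambda>x. p x \<eta> * pure_deriv (int m) u (tube x \<eta>) + q x \<eta> * pure_deriv (- int m) u (tube x \<eta>) + e u x \<eta>)
      has_vector_derivative
      (p x \<eta> * tube_s x \<eta>) * pure_deriv (int (Suc m)) u (tube x \<eta>) +
      (q x \<eta> * cnj (tube_s x \<eta>)) * pure_deriv (- int (Suc m)) u (tube x \<eta>) + e' u x \<eta>) (at x)"
proof -
  obtain p' where p': "p' \<in> coef" "\<And>u x \<eta>. solution u \<Longrightarrow> (x, \<eta>) \<in> tube_domain \<Longrightarrow>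
    ((\<lambda>x. p x \<eta> * pure_deriv (int m) u (tube x \<eta>)) has_vector_derivative
      (p x \<eta> * tube_s x \<eta> * dz_coef (int m)) * pure_deriv (int m + 1) u (tube x \<eta>) +
      (p x \<eta> * cnj (tube_s x \<eta>) * dzbar_coef (int m)) * pure_deriv (int m - 1) u (tube x \<eta>) +
      p' x \<eta> * pure_deriv (int m) u (tube x \<eta>)) (at x)"
    using term_deriv_s[OF assms(1), of "int m"] by blast
  obtain q' where q': "q' \<in> coef" "\<And>u x \<eta>. solution u \<Longrightarrow> (x, \<eta>) \<in> tube_domain \<Longrightarrow>
    ((\<lambda>x. q x \<eta> * pure_deriv (- int m) u (tube x \<eta>)) has_vector_derivative
      (q x \<eta> * tube_s x \<eta> * dz_coef (- int m)) * pure_deriv (- int m + 1) u (tube x \<eta>) +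
      (q x \<eta> * cnj (tube_s x \<eta>) * dzbar_coef (- int m)) * pure_deriv (- int m - 1) u (tube x \<eta>) +
      q' x \<eta> * pure_deriv (- int m) u (tube x \<eta>)) (at x)"
    using term_deriv_s[OF assms(2), of "- int m"] by blast
  obtain e' where e': "e' \<in> expr (Suc m)" "\<And>u x \<eta>. solution u \<Longrightarrow> (x, \<eta>) \<in> tube_domain \<Longrightarrow>
      ((\<lambda>x. e u x \<eta>) has_vector_derivative e' u x \<eta>) (at x)"
    using expr_deriv_s[OF assms(3)] by blast
  define r where "r = (\<lambda>u x \<eta>.
      (p x \<eta> * cnj (tube_s x \<eta>) * dzbar_coef (int m)) * pure_deriv (int m - 1) u (tube x \<eta>) +
      p' x \<eta> * pure_deriv (int m) u (tube x \<eta>) +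
      ((q x \<eta> * tube_s x \<eta> * dz_coef (- int m)) * pure_deriv (- int m + 1) u (tube x \<eta>) +
      q' x \<eta> * pure_deriv (- int m) u (tube x \<eta>)) + e' u x \<eta>)"
  have int_Suc: "int (Suc m) = int m + 1" "- int (Suc m) = - int m - 1" by simp_all
  have one: "dz_coef (int m) = 1" "dzbar_coef (- int m) = 1" by (simp_all add: dz_coef_def dzbar_coef_def)
  show thesis
  proof (rule that)
    \<comment> \<open>For m = 0 the inward indices m - 1 and 1 - m would have absolute value 1, too
      large for the remainder; hence the assumption that m is positive.\<close>
    show "r \<in> expr (Suc m)" unfolding r_def
      by (intro expr.add expr.pure coef.mult coef.const coef_tube_s coef_cnj p'(1) q'(1) e'(1) assms)
        (use assms(4) in auto)
    fix u x \<eta> assume *: "solution u" "(x, \<eta>) \<in> tube_domain"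
    show "((\<lambda>x. p x \<eta> * pure_deriv (int m) u (tube x \<eta>) + q x \<eta> * pure_deriv (- int m) u (tube x \<eta>) + e u x \<eta>)
      has_vector_derivative
      (p x \<eta> * tube_s x \<eta>) * pure_deriv (int (Suc m)) u (tube x \<eta>) +
      (q x \<eta> * cnj (tube_s x \<eta>)) * pure_deriv (- int (Suc m)) u (tube x \<eta>) + r u x \<eta>) (at x)"
      unfolding int_Suc
      by (rule has_vector_derivative_eq_rhs[OF has_vector_derivative_add[OF
            has_vector_derivative_add[OF p'(2)[OF *] q'(2)[OF *]] e'(2)[OF *]]])
        (simp add: r_def one)
  qed
qed

text \<open>An arbitrary first-order \<open>F\<close> lets the statement serve both families of
  data. The count starts at order one because at order zero the two pure derivatives
  coincide.\<close>

lemma tangential_derivatives: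
  assumes "p \<in> coef" "q \<in> coef"
    and F: "\<And>u x \<eta>. solution u \<Longrightarrow> (x, \<eta>) \<in> tube_domain \<Longrightarrow>
      F u x \<eta> = p x \<eta> * pure_deriv 1 u (tube x \<eta>) + q x \<eta> * pure_deriv (- 1) u (tube x \<eta>)"
  shows "\<exists>e \<in> expr (Suc j). \<forall>u x \<eta>. solution u \<longrightarrow> (x, \<eta>) \<in> tube_domain \<longrightarrow>
    hder j (\<lambda>x. F u x \<eta>) x =
      (p x \<eta> * tube_s x \<eta> ^ j) * pure_deriv (int (Suc j)) u (tube x \<eta>) +
      (q x \<eta> * cnj (tube_s x \<eta>) ^ j) * pure_deriv (- int (Suc j)) u (tube x \<eta>) + e u x \<eta>"
proof (induction j)
  case 0
  show ?case by (rule bexI[OF _ expr.zero]) (simp add: F)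
next
  case (Suc j)
  let ?G = "\<lambda>j e u x \<eta>. (p x \<eta> * tube_s x \<eta> ^ j) * pure_deriv (int (Suc j)) u (tube x \<eta>) +
      (q x \<eta> * cnj (tube_s x \<eta>) ^ j) * pure_deriv (- int (Suc j)) u (tube x \<eta>) + e u x \<eta>"
  obtain e where e: "e \<in> expr (Suc j)" "\<And>u x \<eta>. solution u \<Longrightarrow> (x, \<eta>) \<in> tube_domain \<Longrightarrow>
      hder j (\<lambda>x. F u x \<eta>) x = ?G j e u x \<eta>"
    using Suc.IH by blast
  have "(\<lambda>x \<eta>. p x \<eta> * tube_s x \<eta> ^ j) \<in> coef" "(\<lambda>x \<eta>. q x \<eta> * cnj (tube_s x \<eta>) ^ j) \<in> coef"
    by (intro coef.mult assms coef_power coef_cnj coef_tube_s)+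
  from leading_deriv_s[OF this e(1)]
  obtain e' where e': "e' \<in> expr (Suc (Suc j))" "\<And>u x \<eta>. solution u \<Longrightarrow> (x, \<eta>) \<in> tube_domain \<Longrightarrow>
    ((\<lambda>x. ?G j e u x \<eta>) has_vector_derivative
      (p x \<eta> * tube_s x \<eta> ^ j * tube_s x \<eta>) * pure_deriv (int (Suc (Suc j))) u (tube x \<eta>) +
      (q x \<eta> * cnj (tube_s x \<eta>) ^ j * cnj (tube_s x \<eta>)) * pure_deriv (- int (Suc (Suc j))) u (tube x \<eta>) + e' u x \<eta>) (at x)"
    by blast
  have "hder (Suc j) (\<lambda>x. F u x \<eta>) x = ?G (Suc j) e' u x \<eta>"
    if *: "solution u" "(x, \<eta>) \<in> tube_domain" for u x \<eta>
  proof -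
    have "(hder j (\<lambda>x. F u x \<eta>) has_vector_derivative ?G (Suc j) e' u x \<eta>) (at x)"
    \<comment> \<open>The formula for \<open>hder j\<close> is known only for parameters in the
      strip; they form an open interval, which is enough to differentiate once more.\<close>
    proof (rule has_vector_derivative_transform_within_open)
      show "((\<lambda>x. ?G j e u x \<eta>) has_vector_derivative ?G (Suc j) e' u x \<eta>) (at x)"
        using e'(2)[OF *] by (simp only: power_Suc2 mult.assoc)
      show "open {s\<^sub>0 - \<delta><..<s\<^sub>0 + \<delta>}" by simp
      show "x \<in> {s\<^sub>0 - \<delta><..<s\<^sub>0 + \<delta>}" using *(2) by (simp add: tube_domain_def)
      show "?G j e u y \<eta> = hder j (\<lambda>x. F u x \<eta>) y" if "y \<in> {s\<^sub>0 - \<delta><..<s\<^sub>0 + \<delta>}" for y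
        using e(2)[of u y \<eta>] * that by (simp add: tube_domain_def)
    qed
    then show ?thesis by (simp only: hder.simps vector_derivative_at)
  qed
  then show ?case using e'(1) by blast
qed

lemma hder_1_bcoord_s:
  assumes "solution u" "(x, \<eta>) \<in> tube_domain"
  shows "hder 1 (\<lambda>x. bcoord D \<gamma> u x \<eta>) x =
    tube_s x \<eta> * pure_deriv 1 u (tube x \<eta>) + cnj (tube_s x \<eta>) * pure_deriv (- 1) u (tube x \<eta>)" (is "_ = ?d")
proof -
  have "((\<lambda>x. bcoord D \<gamma> u x \<eta>) has_vector_derivative ?d) (at x)"
  proof (rule has_vector_derivative_transform_within_open)
    show "((\<lambda>x. pure_deriv 0 u (tube x \<eta>)) has_vector_derivative ?d) (at x)"
      using pure_deriv_compose[OF assms(1) tube_in_exterior[OF assms(2)] tube_has_vector_derivative_s, of 0]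
      by (simp add: dz_coef_def dzbar_coef_def)
    show "open {s\<^sub>0 - \<delta><..<s\<^sub>0 + \<delta>}" by simp
    show "x \<in> {s\<^sub>0 - \<delta><..<s\<^sub>0 + \<delta>}" using assms(2) by (simp add: tube_domain_def)
  qed (simp add: bcoord_eq)
  then show ?thesis by (simp add: vector_derivative_at)
qed

lemma hder_1_bcoord_\<eta>:
  assumes "solution u" "(x, \<eta>) \<in> tube_domain"
  shows "hder 1 (bcoord D \<gamma> u x) \<eta> =
    (\<nu> * tangent x) * pure_deriv 1 u (tube x \<eta>) + cnj (\<nu> * tangent x) * pure_deriv (- 1) u (tube x \<eta>)" (is "_ = ?d")
proof -
  have "x \<in> {s\<^sub>0 - \<delta><..<s\<^sub>0 + \<delta>}" using assms(2) by (simp add: tube_domain_def)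
  then have "bcoord D \<gamma> u x = (\<lambda>\<eta>. pure_deriv 0 u (tube x \<eta>))" by (simp add: bcoord_eq fun_eq_iff)
  moreover have "((\<lambda>\<eta>. pure_deriv 0 u (tube x \<eta>)) has_vector_derivative ?d) (at \<eta>)"
    using pure_deriv_compose[OF assms(1) tube_in_exterior[OF assms(2)] tube_has_vector_derivative_\<eta>, of 0]
    by (simp add: dz_coef_def dzbar_coef_def)
  ultimately show ?thesis by (simp add: vector_derivative_at)
qed

text \<open>Only the order is recorded: all jets of order at most N are recovered from the data
  separately, so no leading coefficient is required.\<close>

lemma normal_derivatives:
  "\<exists>e \<in> expr (Suc N). \<forall>u \<eta>. solution u \<longrightarrow> (s\<^sub>0, \<eta>) \<in> tube_domain \<longrightarrow>
    hder N (bcoord D \<gamma> u s\<^sub>0) \<eta> = e u s\<^sub>0 \<eta>"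
proof (induction N)
  case 0
  have "(\<lambda>u x \<eta>. 1 * pure_deriv 0 u (tube x \<eta>)) \<in> expr (Suc 0)"
    by (intro expr.pure coef.const) auto
  then show ?case by (rule bexI[rotated]) (use \<delta>_pos in \<open>simp add: bcoord_eq\<close>)
next
  case (Suc N)
  then obtain e where e: "e \<in> expr (Suc N)" "\<And>u \<eta>. solution u \<Longrightarrow> (s\<^sub>0, \<eta>) \<in> tube_domain \<Longrightarrow>
      hder N (bcoord D \<gamma> u s\<^sub>0) \<eta> = e u s\<^sub>0 \<eta>" by blast
  obtain e' where e': "e' \<in> expr (Suc (Suc N))" "\<And>u x \<eta>. solution u \<Longrightarrow> (x, \<eta>) \<in> tube_domain \<Longrightarrow>
      (e u x has_vector_derivative e' u x \<eta>) (at \<eta>)"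
    using expr_deriv_\<eta>[OF e(1)] by blast
  have "hder (Suc N) (bcoord D \<gamma> u s\<^sub>0) \<eta> = e' u s\<^sub>0 \<eta>" if *: "solution u" "(s\<^sub>0, \<eta>) \<in> tube_domain" for u \<eta>
  proof -
    have "(hder N (bcoord D \<gamma> u s\<^sub>0) has_vector_derivative e' u s\<^sub>0 \<eta>) (at \<eta>)"
    proof (rule has_vector_derivative_transform_within_open[OF e'(2)[OF *]])
      show "open {0<..<\<delta>}" by simp
      show "\<eta> \<in> {0<..<\<delta>}" using *(2) by (simp add: tube_domain_def)
      show "e u s\<^sub>0 y = hder N (bcoord D \<gamma> u s\<^sub>0) y" if "y \<in> {0<..<\<delta>}" for y
        using e(2)[of u y] * that \<delta>_pos by (simp add: tube_domain_def)
    qed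
    then show ?thesis by (simp add: vector_derivative_at)
  qed
  then show ?case using e'(1) by blast
qed

section \<open>Boundary values of the pure derivatives and the span of the boundary data\<close>

definition boundary_jet :: "int \<Rightarrow> (complex \<Rightarrow> complex) \<Rightarrow> complex" where
  "boundary_jet i u = Lim (at_right 0) (\<lambda>\<eta>. pure_deriv i u (tube s\<^sub>0 \<eta>))"

lemma eventually_tube_domain: "\<forall>\<^sub>F \<eta> in at_right 0. (s\<^sub>0, \<eta>) \<in> tube_domain"
  using \<delta>_pos by (auto simp: eventually_at_right tube_domain_def intro!: exI[of _ \<delta>])

text \<open>The continuous extension provided by smoothness up to the boundary supplies the limit,
  which makes \<open>Lim\<close> in \<open>boundary_jet\<close> a genuine one.\<close>

lemma boundary_jet_tendsto:
  assumes "solution u"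
  shows "((\<lambda>\<eta>. pure_deriv i u (tube s\<^sub>0 \<eta>)) \<longlongrightarrow> boundary_jet i u) (at_right 0)"
proof -
  have "smooth_up_to_boundary (exterior D) (pure_deriv i u)"
    using assms open_exterior by (auto simp: helmholtz_solution_def intro: smooth_up_to_boundary_pure_deriv)
  then obtain g where g: "continuous_on (closure (exterior D)) g"
    "\<And>z. z \<in> exterior D \<Longrightarrow> g z = pder [] (pure_deriv i u) z"
    unfolding smooth_up_to_boundary_def by metis
  have tube: "(tube s\<^sub>0 \<longlongrightarrow> tube s\<^sub>0 0) (at_right 0)"
    using has_vector_derivative_continuous[OF tube_has_vector_derivative_\<eta>[of s\<^sub>0 0]]
    by (simp add: continuous_at filterlim_at_split)
  have ev: "\<forall>\<^sub>F \<eta> in at_right 0. tube s\<^sub>0 \<eta> \<in> exterior D"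
    using eventually_tube_domain by eventually_elim (rule tube_in_exterior)
  have "tube s\<^sub>0 0 \<in> closure (exterior D)"
    using frontier_subset_closure_exterior \<gamma>_in_frontier by (auto simp: tube_def)
  moreover have "\<forall>\<^sub>F \<eta> in at_right 0. tube s\<^sub>0 \<eta> \<in> closure (exterior D)"
    using ev by eventually_elim (use closure_subset in blast)
  ultimately have "((\<lambda>\<eta>. g (tube s\<^sub>0 \<eta>)) \<longlongrightarrow> g (tube s\<^sub>0 0)) (at_right 0)"
    using continuous_on_tendsto_compose[OF g(1) tube] by blast
  then have "((\<lambda>\<eta>. pure_deriv i u (tube s\<^sub>0 \<eta>)) \<longlongrightarrow> g (tube s\<^sub>0 0)) (at_right 0)"
    by (rule Lim_transform_eventually) (use ev in eventually_elim, use g(2) in auto)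
  then show ?thesis unfolding boundary_jet_def by (subst tendsto_Lim) auto
qed

text \<open>Functionals of u at the fixed boundary point. The numbers a and b are chosen before u,
  which encodes independence of u; equality is demanded for solutions only.\<close>

definition boundary_span :: "nat \<Rightarrow> ((complex \<Rightarrow> complex) \<Rightarrow> complex) set" where
  "boundary_span N = {F. \<exists>a b. \<forall>u. solution u \<longrightarrow>
     F u = (\<Sum>j\<le>N. a j * dt_bd D \<gamma> u j s\<^sub>0) + (\<Sum>j\<le>N. b j * dtdn_bd D \<gamma> u j s\<^sub>0)}"

lemma boundary_span_cong:
  assumes "F \<in> boundary_span N" "\<And>u. solution u \<Longrightarrow> G u = F u"
  shows "G \<in> boundary_span N"
  using assms unfolding boundary_span_def by auto

lemma boundary_span_linear:
  assumes "F \<in> boundary_span N" "G \<in> boundary_span N"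
  shows "(\<lambda>u. c * F u + d * G u) \<in> boundary_span N"
proof -
  obtain a b where F: "\<And>u. solution u \<Longrightarrow>
      F u = (\<Sum>j\<le>N. a j * dt_bd D \<gamma> u j s\<^sub>0) + (\<Sum>j\<le>N. b j * dtdn_bd D \<gamma> u j s\<^sub>0)"
    using assms(1) unfolding boundary_span_def by auto
  obtain a' b' where G: "\<And>u. solution u \<Longrightarrow>
      G u = (\<Sum>j\<le>N. a' j * dt_bd D \<gamma> u j s\<^sub>0) + (\<Sum>j\<le>N. b' j * dtdn_bd D \<gamma> u j s\<^sub>0)"
    using assms(2) unfolding boundary_span_def by auto
  have "c * F u + d * G u = (\<Sum>j\<le>N. (c * a j + d * a' j) * dt_bd D \<gamma> u j s\<^sub>0) +
      (\<Sum>j\<le>N. (c * b j + d * b' j) * dtdn_bd D \<gamma> u j s\<^sub>0)" if "solution u" for u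
    by (simp add: F[OF that] G[OF that] algebra_simps sum.distrib sum_distrib_left)
  then show ?thesis unfolding boundary_span_def by (intro CollectI exI allI impI)
qed

lemma boundary_span_zero: "(\<lambda>u. 0) \<in> boundary_span N"
  unfolding boundary_span_def by (auto intro!: exI[of _ "\<lambda>_. 0"])

lemma dt_bd_in_boundary_span:
  assumes "j \<le> N" shows "(\<lambda>u. dt_bd D \<gamma> u j s\<^sub>0) \<in> boundary_span N"
proof -
  have "dt_bd D \<gamma> u j s\<^sub>0 = (\<Sum>i\<le>N. (if i = j then 1 else 0) * dt_bd D \<gamma> u i s\<^sub>0) +
      (\<Sum>i\<le>N. (0) * dtdn_bd D \<gamma> u i s\<^sub>0)" for u
    using assms by (simp add: if_distrib[of "\<lambda>c. c * _"] cong: if_cong)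
  then show ?thesis unfolding boundary_span_def by (intro CollectI exI allI impI)
qed

lemma dtdn_bd_in_boundary_span:
  assumes "j \<le> N" shows "(\<lambda>u. dtdn_bd D \<gamma> u j s\<^sub>0) \<in> boundary_span N"
proof -
  have "dtdn_bd D \<gamma> u j s\<^sub>0 = (\<Sum>i\<le>N. (0) * dt_bd D \<gamma> u i s\<^sub>0) +
      (\<Sum>i\<le>N. (if i = j then 1 else 0) * dtdn_bd D \<gamma> u i s\<^sub>0)" for u
    using assms by (simp add: if_distrib[of "\<lambda>c. c * _"] cong: if_cong)
  then show ?thesis unfolding boundary_span_def by (intro CollectI exI allI impI)
qed

lemma boundary_span_mono:
  assumes "M \<le> N" shows "boundary_span M \<subseteq> boundary_span N"
proof
  fix F assume "F \<in> boundary_span M"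
  then obtain a b where F: "\<And>u. solution u \<Longrightarrow>
      F u = (\<Sum>j\<le>M. a j * dt_bd D \<gamma> u j s\<^sub>0) + (\<Sum>j\<le>M. b j * dtdn_bd D \<gamma> u j s\<^sub>0)"
    unfolding boundary_span_def by auto
  have ext: "(\<Sum>j\<le>M. c j * f j) = (\<Sum>j\<le>N. (if j \<le> M then c j else 0) * f j)" for c f :: "nat \<Rightarrow> complex"
    using assms by (intro sum.mono_neutral_cong_left) auto
  show "F \<in> boundary_span N"
    unfolding boundary_span_def using F[unfolded ext[of a] ext[of b]] by (intro CollectI exI allI impI)
qed

text \<open>\<open>m\<close> and \<open>N\<close> are independent because both the remainders of
  order below N and the normal derivative of order N are placed in the span of level N.\<close>

lemma expr_tendsto:
  assumes "e \<in> expr m" "\<And>i. \<bar>i\<bar> < int m \<Longrightarrow> boundary_jet i \<in> boundary_span N"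
  shows "\<exists>F \<in> boundary_span N. \<forall>u. solution u \<longrightarrow> (e u s\<^sub>0 \<longlongrightarrow> F u) (at_right 0)"
  using assms(1)
proof (induction rule: expr.induct)
  case zero
  show ?case by (rule bexI[OF _ boundary_span_zero]) simp
next
  case (pure c i)
  have tr: "boundary_jet i \<in> boundary_span N" using pure assms(2) by blast
  from boundary_span_linear[OF tr tr, of "c s\<^sub>0 0" 0]
  have "(\<lambda>u. c s\<^sub>0 0 * boundary_jet i u) \<in> boundary_span N" by simp
  then show ?case
    by (rule bexI[rotated]) (use pure in \<open>auto intro!: tendsto_mult coef_tendsto boundary_jet_tendsto\<close>)
next
  case (add e f)
  then obtain F G where F: "F \<in> boundary_span N" "\<And>u. solution u \<Longrightarrow> (e u s\<^sub>0 \<longlongrightarrow> F u) (at_right 0)"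
    and G: "G \<in> boundary_span N" "\<And>u. solution u \<Longrightarrow> (f u s\<^sub>0 \<longlongrightarrow> G u) (at_right 0)" by blast
  from boundary_span_linear[OF F(1) G(1), of 1 1]
  have "(\<lambda>u. F u + G u) \<in> boundary_span N" by simp
  then show ?case by (rule bexI[rotated]) (use F(2) G(2) in \<open>auto intro!: tendsto_add\<close>)
qed

lemma boundary_limit:
  assumes "p \<in> coef" "q \<in> coef" "e \<in> expr (Suc j)" "solution u" "(e u s\<^sub>0 \<longlongrightarrow> E) (at_right 0)"
    and H: "\<And>\<eta>. (s\<^sub>0, \<eta>) \<in> tube_domain \<Longrightarrow> H \<eta> =
      (p s\<^sub>0 \<eta> * tube_s s\<^sub>0 \<eta> ^ j) * pure_deriv (int (Suc j)) u (tube s\<^sub>0 \<eta>) +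
      (q s\<^sub>0 \<eta> * cnj (tube_s s\<^sub>0 \<eta>) ^ j) * pure_deriv (- int (Suc j)) u (tube s\<^sub>0 \<eta>) + e u s\<^sub>0 \<eta>"
  shows "Lim (at_right 0) H = (p s\<^sub>0 0 * tangent s\<^sub>0 ^ j) * boundary_jet (int (Suc j)) u +
      (q s\<^sub>0 0 * cnj (tangent s\<^sub>0) ^ j) * boundary_jet (- int (Suc j)) u + E"
proof (rule tendsto_Lim)
  have "(tube_s s\<^sub>0 \<longlongrightarrow> tangent s\<^sub>0) (at_right 0)"
    using coef_tendsto[OF coef_tube_s, of s\<^sub>0] by (simp add: tube_s_def)
  then have "((\<lambda>\<eta>. (p s\<^sub>0 \<eta> * tube_s s\<^sub>0 \<eta> ^ j) * pure_deriv (int (Suc j)) u (tube s\<^sub>0 \<eta>) +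
      (q s\<^sub>0 \<eta> * cnj (tube_s s\<^sub>0 \<eta>) ^ j) * pure_deriv (- int (Suc j)) u (tube s\<^sub>0 \<eta>) + e u s\<^sub>0 \<eta>) \<longlongrightarrow>
      (p s\<^sub>0 0 * tangent s\<^sub>0 ^ j) * boundary_jet (int (Suc j)) u +
      (q s\<^sub>0 0 * cnj (tangent s\<^sub>0) ^ j) * boundary_jet (- int (Suc j)) u + E) (at_right 0)"
    by (intro tendsto_add tendsto_mult tendsto_power tendsto_cnj boundary_jet_tendsto assms coef_tendsto)
  then show "(H \<longlongrightarrow> (p s\<^sub>0 0 * tangent s\<^sub>0 ^ j) * boundary_jet (int (Suc j)) u +
      (q s\<^sub>0 0 * cnj (tangent s\<^sub>0) ^ j) * boundary_jet (- int (Suc j)) u + E) (at_right 0)"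
    by (rule Lim_transform_eventually)
      (use eventually_tube_domain in eventually_elim, simp add: H)
qed simp

text \<open>The leading parts of the \<open>N\<close>th tangential derivatives of \<open>u\<close> and, one order
  lower, of the normal derivative of \<open>u\<close> are \<open>X + Y\<close> and \<open>\<nu> (X - Y)\<close>, where \<open>X\<close> and \<open>Y\<close> are
  unimodular multiples of the boundary values of the two pure derivatives of order \<open>N\<close>.\<close>

lemma boundary_jet_in_boundary_span: "\<bar>i\<bar> \<le> int N \<Longrightarrow> boundary_jet i \<in> boundary_span N"
proof (induction N arbitrary: i)
  case 0
  have "s\<^sub>0 \<in> {s\<^sub>0 - \<delta><..<s\<^sub>0 + \<delta>}" using \<delta>_pos by simp
  then have "boundary_jet 0 u = dt_bd D \<gamma> u 0 s\<^sub>0" for u by (simp add: boundary_jet_def dt_bd_def bcoord_eq)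
  then show ?case using 0 boundary_span_cong[OF dt_bd_in_boundary_span[of 0 0]] by simp
next
  case (Suc N)
  have lower: "boundary_jet i \<in> boundary_span (Suc N)" if "\<bar>i\<bar> < int (Suc N)" for i
    using Suc.IH[of i] boundary_span_mono[of N "Suc N"] that by auto
  let ?\<tau> = "tangent s\<^sub>0"
  define X where "X = (\<lambda>u. ?\<tau> ^ Suc N * boundary_jet (int (Suc N)) u)"
  define Y where "Y = (\<lambda>u. cnj ?\<tau> ^ Suc N * boundary_jet (- int (Suc N)) u)"
  obtain e where e: "e \<in> expr (Suc N)" "\<And>u x \<eta>. solution u \<Longrightarrow> (x, \<eta>) \<in> tube_domain \<Longrightarrow>
      hder N (\<lambda>x. hder 1 (\<lambda>x. bcoord D \<gamma> u x \<eta>) x) x =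
      (tube_s x \<eta> * tube_s x \<eta> ^ N) * pure_deriv (int (Suc N)) u (tube x \<eta>) +
      (cnj (tube_s x \<eta>) * cnj (tube_s x \<eta>) ^ N) * pure_deriv (- int (Suc N)) u (tube x \<eta>) + e u x \<eta>"
    using tangential_derivatives[OF coef_tube_s coef_cnj[OF coef_tube_s] hder_1_bcoord_s, of N] by blast
  obtain F where F: "F \<in> boundary_span (Suc N)" "\<And>u. solution u \<Longrightarrow> (e u s\<^sub>0 \<longlongrightarrow> F u) (at_right 0)"
    using expr_tendsto[OF e(1) lower] by blast
  \<comment> \<open>The derivative of order \<open>Suc N\<close> of u is the one of order
    \<open>N\<close> of its first tangential derivative, whose coefficients are the velocity and its
    conjugate.\<close>
  have dt: "dt_bd D \<gamma> u (Suc N) s\<^sub>0 = X u + Y u + F u" if u: "solution u" for u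
    unfolding dt_bd_def hder_Suc_shift
    using boundary_limit[OF coef_tube_s coef_cnj[OF coef_tube_s] e(1) u F(2)[OF u] e(2)[OF u]]
    by (simp add: X_def Y_def tube_s_def)
  obtain f where f: "f \<in> expr (Suc N)" "\<And>u x \<eta>. solution u \<Longrightarrow> (x, \<eta>) \<in> tube_domain \<Longrightarrow>
      hder N (\<lambda>x. hder 1 (bcoord D \<gamma> u x) \<eta>) x =
      ((\<nu> * tangent x) * tube_s x \<eta> ^ N) * pure_deriv (int (Suc N)) u (tube x \<eta>) +
      (cnj (\<nu> * tangent x) * cnj (tube_s x \<eta>) ^ N) * pure_deriv (- int (Suc N)) u (tube x \<eta>) + f u x \<eta>"
    using tangential_derivatives[OF coef_normal coef_cnj[OF coef_normal] hder_1_bcoord_\<eta>, of N] by blast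
  obtain G where G: "G \<in> boundary_span (Suc N)" "\<And>u. solution u \<Longrightarrow> (f u s\<^sub>0 \<longlongrightarrow> G u) (at_right 0)"
    using expr_tendsto[OF f(1) lower] by blast
  \<comment> \<open>The rotation is purely imaginary: this is the origin of the minus sign in X - Y
    and so of the independence of the two leading parts.\<close>
  have cnj_\<nu>: "cnj \<nu> = - \<nu>" "\<nu> \<noteq> 0" using \<nu> by auto
  have dtdn: "dtdn_bd D \<gamma> u N s\<^sub>0 = \<nu> * (X u - Y u) + G u" if u: "solution u" for u
    unfolding dtdn_bd_def
    using boundary_limit[OF coef_normal coef_cnj[OF coef_normal] f(1) u G(2)[OF u] f(2)[OF u]]
    by (simp add: X_def Y_def cnj_\<nu> algebra_simps)
  \<comment> \<open>Subtracting the limits \<open>F\<close> and \<open>G\<close> of the remainders,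
    already in the span, leaves the two leading parts with arbitrary weights c and d.\<close>
  have "(\<lambda>u. c * (1 * dt_bd D \<gamma> u (Suc N) s\<^sub>0 + (- 1) * F u) + d * (1 * dtdn_bd D \<gamma> u N s\<^sub>0 + (- 1) * G u))
      \<in> boundary_span (Suc N)" for c d
    by (intro boundary_span_linear dt_bd_in_boundary_span dtdn_bd_in_boundary_span F(1) G(1)) auto
  then have comb: "(\<lambda>u. c * (X u + Y u) + d * (\<nu> * (X u - Y u))) \<in> boundary_span (Suc N)" for c d
    by (rule boundary_span_cong) (simp add: dt dtdn)
  have unit: "cnj ?\<tau> ^ Suc N * ?\<tau> ^ Suc N = 1"
  proof -
    have "cnj ?\<tau> * ?\<tau> = 1" using complex_norm_square[of ?\<tau>] by (simp add: mult.commute)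
    then show ?thesis by (simp only: power_mult_distrib[symmetric] power_one)
  qed
  \<comment> \<open>The weights 1 / 2 and 1 / (2 * \<nu>) isolate X, and the conjugate power of the
    tangent removes its unimodular factor. For Y the second weight changes sign and the power of the
    tangent itself is used.\<close>
  have "boundary_jet (int (Suc N)) \<in> boundary_span (Suc N)"
  proof (rule boundary_span_cong[OF comb])
    fix u
    have "boundary_jet (int (Suc N)) u = (cnj ?\<tau> ^ Suc N * ?\<tau> ^ Suc N) * boundary_jet (int (Suc N)) u" by (simp only: unit mult_1)
    also have "\<dots> = cnj ?\<tau> ^ Suc N * X u" by (simp add: X_def)
    also have "\<dots> = (cnj ?\<tau> ^ Suc N / 2) * (X u + Y u) + (cnj ?\<tau> ^ Suc N / (2 * \<nu>)) * (\<nu> * (X u - Y u))"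
      using cnj_\<nu>(2) by (simp add: field_simps)
    finally show "boundary_jet (int (Suc N)) u = \<dots>" .
  qed
  moreover have "boundary_jet (- int (Suc N)) \<in> boundary_span (Suc N)"
  proof (rule boundary_span_cong[OF comb])
    fix u
    have "boundary_jet (- int (Suc N)) u = (cnj ?\<tau> ^ Suc N * ?\<tau> ^ Suc N) * boundary_jet (- int (Suc N)) u" by (simp only: unit mult_1)
    also have "\<dots> = ?\<tau> ^ Suc N * Y u" by (simp add: Y_def)
    also have "\<dots> = (?\<tau> ^ Suc N / 2) * (X u + Y u) + (- (?\<tau> ^ Suc N / (2 * \<nu>))) * (\<nu> * (X u - Y u))"
      using cnj_\<nu>(2) by (simp add: field_simps)
    finally show "boundary_jet (- int (Suc N)) u = \<dots>" .
  qed
  moreover have "\<bar>i\<bar> < int (Suc N) \<or> i = int (Suc N) \<or> i = - int (Suc N)" using Suc.prems by linarith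
  ultimately show ?case using lower by blast
qed

lemma dn_bd_in_boundary_span: "(\<lambda>u. dn_bd D \<gamma> u N s\<^sub>0) \<in> boundary_span N"
proof -
  obtain e where e: "e \<in> expr (Suc N)" "\<And>u \<eta>. solution u \<Longrightarrow> (s\<^sub>0, \<eta>) \<in> tube_domain \<Longrightarrow>
      hder N (bcoord D \<gamma> u s\<^sub>0) \<eta> = e u s\<^sub>0 \<eta>"
    using normal_derivatives[of N] by blast
  have "\<exists>F \<in> boundary_span N. \<forall>u. solution u \<longrightarrow> (e u s\<^sub>0 \<longlongrightarrow> F u) (at_right 0)"
    by (rule expr_tendsto[OF e(1)]) (simp add: boundary_jet_in_boundary_span)
  then obtain F where F: "F \<in> boundary_span N" "\<And>u. solution u \<Longrightarrow> (e u s\<^sub>0 \<longlongrightarrow> F u) (at_right 0)"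
    by blast
  show ?thesis
  proof (rule boundary_span_cong[OF F(1)])
    fix u assume u: "solution u"
    have "(hder N (bcoord D \<gamma> u s\<^sub>0) \<longlongrightarrow> F u) (at_right 0)"
      by (rule Lim_transform_eventually[OF F(2)[OF u]])
        (use eventually_tube_domain in eventually_elim, simp add: e(2) u)
    then show "dn_bd D \<gamma> u N s\<^sub>0 = F u"
      unfolding dn_bd_def by (intro tendsto_Lim) simp_all
  qed
qed

end

theorem theorem3p1:
  fixes D :: "complex set" and \<gamma> :: "real \<Rightarrow> complex" and L \<alpha> k imp :: real
  assumes "open D" and "bounded D" and "simply_connected D"
    and "L > 0"
    and "smooth_real_fun \<gamma>"
    and "\<forall>s. \<gamma> (s + L) = \<gamma> s"
    and "\<forall>s. norm (vector_derivative \<gamma> (at s)) = 1"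
    and "inj_on \<gamma> {0..<L}"
    and "\<gamma> ` {0..L} = frontier D"
    and "\<alpha> > 0" and "k > 0"
  shows "\<forall>N::nat. \<exists>a b :: nat \<Rightarrow> real \<Rightarrow> complex.
           \<forall>u. scattered_field D \<gamma> L \<alpha> k imp u \<longrightarrow>
             (\<forall>s\<in>{0..L}. dn_bd D \<gamma> u N s =
                (\<Sum>j\<le>N. a j s * dt_bd D \<gamma> u j s) + (\<Sum>j\<le>N. b j s * dtdn_bd D \<gamma> u j s))"
proof
  fix N :: nat
  interpret jordan_domain D \<gamma> L
    by unfold_locales (simp_all add: assms)
  \<comment> \<open>Since \<nu> and \<delta> depend on s, the strip is built afresh at each boundary
    point, and the coefficients there are numbers.\<close>
  have "\<exists>a b. \<forall>u. helmholtz_solution (exterior D) \<alpha> k u \<longrightarrow> dn_bd D \<gamma> u N s =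
      (\<Sum>j\<le>N. a j * dt_bd D \<gamma> u j s) + (\<Sum>j\<le>N. b j * dtdn_bd D \<gamma> u j s)" (is "\<exists>a b. ?P s a b") for s
  proof (rule out_normal_locally[of s])
    fix \<nu> \<delta>
    assume *: "\<nu> \<in> {\<i>, - \<i>}" "\<delta> > 0"
      "\<And>x. \<bar>x - s\<bar> < \<delta> \<Longrightarrow> out_normal D \<gamma> x = \<nu> * tangent x"
      "\<And>x \<eta>. \<bar>x - s\<bar> < \<delta> \<Longrightarrow> 0 < \<eta> \<Longrightarrow> \<eta> < \<delta> \<Longrightarrow> \<gamma> x + of_real \<eta> * (\<nu> * tangent x) \<in> exterior D"
    interpret normal_tube D \<gamma> L s \<nu> \<delta> \<alpha> k
      by (unfold_locales; (rule *(1) | rule *(2) | rule assms(10) | erule *(3) | erule (2) *(4)))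
    show ?thesis using dn_bd_in_boundary_span[of N] unfolding boundary_span_def by (rule CollectD)
  qed
  \<comment> \<open>Pairing a with b lets one application of choice turn these numbers into
    functions of s.\<close>
  then have "\<forall>s. \<exists>c. ?P s (fst c) (snd c)" by simp
  from choice[OF this] obtain c where c: "\<forall>s. ?P s (fst (c s)) (snd (c s))" ..
  have sol: "helmholtz_solution (exterior D) \<alpha> k u" if "scattered_field D \<gamma> L \<alpha> k imp u" for u
    using that unfolding scattered_field_def helmholtz_solution_def by blast
  show "\<exists>a b :: nat \<Rightarrow> real \<Rightarrow> complex. \<forall>u. scattered_field D \<gamma> L \<alpha> k imp u \<longrightarrow>
      (\<forall>s\<in>{0..L}. dn_bd D \<gamma> u N s =
        (\<Sum>j\<le>N. a j s * dt_bd D \<gamma> u j s) + (\<Sum>j\<le>N. b j s * dtdn_bd D \<gamma> u j s))"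
    by (rule exI[of _ "\<lambda>j s. fst (c s) j"], rule exI[of _ "\<lambda>j s. snd (c s) j"], intro allI impI ballI)
      (rule c[rule_format, OF sol])
qed

end
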